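(* Let $k$ be a field of characteristic zero and consider the free post-Lie algebra $P=\mathrm{Lie}(\mathrm{OT})$ on one generator $\bullet$, with $T(\mathrm{OT}^{\circledast})$ and $T^\circ(\mathrm{OT}^{\circledast})$ as in the context. The co-substitution $\Delta_\star:T(\mathrm{OT}^{\circledast})\to T^\circ(\mathrm{OT}^{\circledast})\otimes T(\mathrm{OT}^{\circledast})$ satisfies, for every nonempty (dual) ordered forest $\omega$, the recursion $$\Delta_\star(\omega)=\sum_{\Delta_\bullet(\omega)}{\sqcup\!\sqcup}_{13}\,\cdot_{24}\;\Delta_\star(\omega_1)\otimes\overline U^{T}_\star(\omega_2) =\sum_{\Delta_\bullet(\omega)}\ \sum_{\Delta_\rhd(\omega_2)}{\sqcup\!\sqcup}_{135}\,\cdot_{24}\;\Delta_\star(\omega_1)\otimes B^+\bigl(\Delta_\star(\omega_2^{(1)})\bigr)\otimes\pi(\omega_2^{(2)}).$$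
   Context: **Free post-Lie algebra.** A post-Lie algebra is a Lie algebra $(P,[\,,])$ with a bilinear map $\rhd$ such that $x\rhd[y,z]=[x\rhd y,z]+[y,x\rhd z]$ and $[x,y]\rhd z=a(x,y,z)-a(y,x,z)$, $a(x,y,z)=x\rhd(y\rhd z)-(x\rhd y)\rhd z$. $\mathrm{OT}$ is the set of rooted planar (ordered) trees; for trees $t,s$, $t\rhd s$ is the sum of all trees obtained by attaching the root of $t$ by a new edge to a vertex of $s$, as leftmost branch at that vertex. $P=\mathrm{Lie}(\mathrm{OT})$ is the free Lie algebra on $\mathrm{OT}$ with $\rhd$ extended by the post-Lie relations; it is the free post-Lie algebra on the one-vertex tree $\bullet$, graded by number of vertices. Its enveloping algebra is the tensor algebra $T(\mathrm{OT})$ with concatenation product, with basis the ordered forests (words of trees), and $\rhd$ extends to $T(\mathrm{OT})$ by $1\rhd A=A$, $A\rhd1=\epsilon(A)1$, $(xA)\rhd y=x\rhd(A\rhd y)-(x\rhd A)\rhd y$, $A\rhd(BD)=\sum(A_{(1)}\rhd B)(A_{(2)}\rhd D)$ for $x,y\in P$, where $\Delta A=\sum A_{(1)}\otimes A_{(2)}$ is the coproduct for which elements of $P$ are primitive. $\hat P$ and $\hat T(\mathrm{OT})$ are the completions by degree. **Dual side.** $T(\mathrm{OT}^{\circledast})$ is the graded dual of $T(\mathrm{OT})$, with basis dual to ordered forests. It has the shuffle product ${\sqcup\!\sqcup}$, concatenation $\cdot$, the deconcatenation coproduct $\Delta_\bullet(\omega)=\sum\omega_1\otimes\omega_2$ (dual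 to concatenation, including terms with an empty factor), and the map $\Delta_\rhd(\omega)=\sum\omega^{(1)}\otimes\omega^{(2)}$ dual to $\rhd:T(\mathrm{OT})\otimes T(\mathrm{OT})\to T(\mathrm{OT})$. $T^\circ(\mathrm{OT}^{\circledast})$ denotes the same vector space with the shuffle product; as an algebra it is identified with $\mathrm{Sym}(P^{\circledast})$, the coordinate ring of $\mathrm{Hom}_k(\langle\bullet\rangle,\hat P)=\hat P$, with $p\in\hat P$ corresponding to the character $\omega\mapsto\langle\exp(p),\omega\rangle$ ($\exp$ taken with concatenation in $\hat T(\mathrm{OT})$). **Co-substitution.** For $p\in\hat P$, let $a_p$ be the continuous endomorphism of the algebra $\hat T(\mathrm{OT})$ (for concatenation) induced by the post-Lie endomorphism of $\hat P$ with $\bullet\mapsto p$. $\Delta_\star$ is the linear map determined by $\langle a_p(A),\omega\rangle=\sum\langle\exp(p),\omega'\rangle\langle A,\omega''\rangle$ for all $p\in\hat P$, $A\in T(\mathrm{OT})$, where $\Delta_\star(\omega)=\sum\omega'\otimes\omega''$ with $\omega'\in T^\circ(\mathrm{OT}^{\circledast})$. $\overline U_\star^T(\omega)$ is $\Delta_\star(\omega)$ with its second factor projected to the span $\mathrm{OT}^{\circledast}$ of (dual) single trees. **Other notation.** $B^+$ turns a (dual) ordered forest into the (dual) tree obtained by attaching its trees to a new root; in $B^+(\Delta_\star(\cdot))$ it is applied to the second tensor factor. $\pi$ is the Euler idempotent of the Hopf algebra $T(\mathrm{OT}^{\circledast})$ with shuffle product and deconcatenation: $\pi=J-J^{\star2}/2+J^{\star3}/3-\cdots$,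 where $J$ is the identity minus unit$\,\circ\,$counit and $\star$ is convolution; its values are considered in $T^\circ(\mathrm{OT}^{\circledast})$. The subscripts refer to positions of tensor factors: ${\sqcup\!\sqcup}_{13}$ (resp. ${\sqcup\!\sqcup}_{135}$) takes the shuffle product of factors $1,3$ (resp. $1,3,5$), which lie in $T^\circ(\mathrm{OT}^{\circledast})$, giving the first factor of the result; $\cdot_{24}$ concatenates factors $2,4$ (in this order), which lie in $T(\mathrm{OT}^{\circledast})$, giving the second factor. *)

theory Defs
  imports Complex_Main "HOL-Library.Poly_Mapping"
begin

section \<open>Vector spaces with a basis, and their tensor products\<close>

text \<open>
  A vector space with basis \<open>'a\<close> is the type \<open>'a \<Rightarrow>\<^sub>0 'k\<close> of finitely supported functions. The tensor
  product of the spaces with bases \<open>'a\<close> and \<open>'b\<close> is \<open>('a \<times> 'b) \<Rightarrow>\<^sub>0 'k\<close>. A linear map is given by its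
  values on the basis and extended by \<open>lin_ext\<close>, a bilinear one by \<open>bilin_ext\<close>.
\<close>

abbreviation lookup :: "('a \<Rightarrow>\<^sub>0 'b::zero) \<Rightarrow> 'a \<Rightarrow> 'b" where
  "lookup \<equiv> Poly_Mapping.lookup"

abbreviation keys :: "('a \<Rightarrow>\<^sub>0 'b::zero) \<Rightarrow> 'a set" where
  "keys \<equiv> Poly_Mapping.keys"

definition basis :: "'a \<Rightarrow> ('a \<Rightarrow>\<^sub>0 'k::field_char_0)" where
  "basis a = Poly_Mapping.single a 1"

definition scale :: "'k::field_char_0 \<Rightarrow> ('a \<Rightarrow>\<^sub>0 'k) \<Rightarrow> ('a \<Rightarrow>\<^sub>0 'k)" (infixr \<open>*\<^sub>k\<close> 75) where
  "c *\<^sub>k x = Poly_Mapping.map ((*) c) x"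

definition lin_ext :: "('a \<Rightarrow> ('b \<Rightarrow>\<^sub>0 'k)) \<Rightarrow> ('a \<Rightarrow>\<^sub>0 'k) \<Rightarrow> ('b \<Rightarrow>\<^sub>0 'k::field_char_0)" where
  "lin_ext f x = (\<Sum>a\<in>keys x. lookup x a *\<^sub>k f a)"

definition tensor :: "('a \<Rightarrow>\<^sub>0 'k) \<Rightarrow> ('b \<Rightarrow>\<^sub>0 'k) \<Rightarrow> ('a \<times> 'b \<Rightarrow>\<^sub>0 'k::field_char_0)"
    (infixr \<open>\<otimes>\<close> 65) where
  "x \<otimes> y = lin_ext (\<lambda>a. lin_ext (\<lambda>b. basis (a, b)) y) x"

definition bilin_ext ::
    "('a \<Rightarrow> 'b \<Rightarrow> ('c \<Rightarrow>\<^sub>0 'k)) \<Rightarrow> ('a \<Rightarrow>\<^sub>0 'k) \<Rightarrow> ('b \<Rightarrow>\<^sub>0 'k) \<Rightarrow> ('c \<Rightarrow>\<^sub>0 'k::field_char_0)" where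
  "bilin_ext f x y = lin_ext (\<lambda>(a, b). f a b) (x \<otimes> y)"

text \<open>
  The pairing of a formal series \<open>A\<close>, i.e. an arbitrary function on the basis, with an element of
  the space with the dual basis.
\<close>

definition pairing :: "('a \<Rightarrow> 'k) \<Rightarrow> ('a \<Rightarrow>\<^sub>0 'k) \<Rightarrow> 'k::field_char_0" where
  "pairing A x = (\<Sum>a\<in>keys x. A a * lookup x a)"


section \<open>Planar trees, ordered forests and grafting\<close>

datatype tree = Node "tree list"

type_synonym forest = "tree list"

abbreviation bullet :: tree where
  "bullet \<equiv> Node []"

fun vertices :: "tree \<Rightarrow> nat" where
  "vertices (Node F) = Suc (\<Sum>t\<leftarrow>F. vertices t)"

definition deg :: "forest \<Rightarrow> nat" where
  "deg F = (\<Sum>t\<leftarrow>F. vertices t)"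

text \<open>
  \<open>graft t s\<close> lists, with multiplicity, the trees obtained by attaching \<open>t\<close> as leftmost branch at a
  vertex of \<open>s\<close>; \<open>graft_forest t F\<close> does so for the vertices of a forest. The latter is the rule
  for \<open>t \<rhd> (BD)\<close> with \<open>t\<close> primitive, so that \<open>t \<rhd> (s1 ... sn)\<close> is the sum of the words
  \<open>s1 ... (t \<rhd> si) ... sn\<close>.
\<close>

fun graft :: "tree \<Rightarrow> tree \<Rightarrow> tree list"
  and graft_forest :: "tree \<Rightarrow> forest \<Rightarrow> forest list" where
  "graft t (Node F) = Node (t # F) # map Node (graft_forest t F)"
| "graft_forest t [] = []"
| "graft_forest t (s # F) = map (\<lambda>s'. s' # F) (graft t s) @ map (\<lambda>F'. s # F') (graft_forest t F)"

definition sum_words :: "'a list \<Rightarrow> ('a \<Rightarrow>\<^sub>0 'k::field_char_0)" where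
  "sum_words ws = (\<Sum>w\<leftarrow>ws. basis w)"

lemma length_graft_forest: "A' \<in> set (graft_forest t A) \<Longrightarrow> length A' = length A"
  by (induction A arbitrary: A') auto


section \<open>The tensor algebra on trees and its post-Lie product\<close>

definition conc :: "(forest \<Rightarrow>\<^sub>0 'k) \<Rightarrow> (forest \<Rightarrow>\<^sub>0 'k) \<Rightarrow> (forest \<Rightarrow>\<^sub>0 'k::field_char_0)"
    (infixl \<open>\<cdot>\<close> 70) where
  "(\<cdot>) = bilin_ext (\<lambda>u v. basis (u @ v))"

text \<open>
  The terms of the coproduct of a word: it is multiplicative for concatenation, and trees are
  primitive.
\<close>

fun unshuffle :: "forest \<Rightarrow> (forest \<times> forest) list" where
  "unshuffle [] = [([], [])]"
| "unshuffle (t # A) = map (\<lambda>(B, C). (t # B, C)) (unshuffle A) @ map (\<lambda>(B, C). (B, t # C)) (unshuffle A)"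

text \<open>
  \<open>A \<rhd> s\<close> for a word \<open>A\<close> and a single tree \<open>s\<close>, by the rules \<open>1 \<rhd> s = s\<close> and
  \<open>(tA) \<rhd> s = t \<rhd> (A \<rhd> s) - (t \<rhd> A) \<rhd> s\<close>; the result is a combination of words of length one.
\<close>

function act_tree :: "forest \<Rightarrow> tree \<Rightarrow> (forest \<Rightarrow>\<^sub>0 'k::field_char_0)" where
  "act_tree [] s = basis [s]"
| "act_tree (t # A) s =
     lin_ext (\<lambda>B. sum_words (graft_forest t B)) (act_tree A s)
     - (\<Sum>A'\<leftarrow>graft_forest t A. act_tree A' s)"
  by pat_completeness auto
termination
  by (relation "measure (\<lambda>(A, s). length A)") (auto dest: length_graft_forest)

text \<open>
  \<open>A \<rhd> F\<close> for words \<open>A\<close> and \<open>F\<close>, by the rules \<open>A \<rhd> 1 = \<epsilon>(A)1\<close> and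
  \<open>A \<rhd> (sD) = \<Sum>(A1 \<rhd> s)(A2 \<rhd> D)\<close>.
\<close>

fun act :: "forest \<Rightarrow> forest \<Rightarrow> (forest \<Rightarrow>\<^sub>0 'k::field_char_0)" where
  "act A [] = (if A = [] then basis [] else 0)"
| "act A (s # D) = (\<Sum>(A1, A2)\<leftarrow>unshuffle A. act_tree A1 s \<cdot> act A2 D)"

definition tri :: "(forest \<Rightarrow>\<^sub>0 'k) \<Rightarrow> (forest \<Rightarrow>\<^sub>0 'k) \<Rightarrow> (forest \<Rightarrow>\<^sub>0 'k::field_char_0)"
    (infixr \<open>\<rhd>\<close> 70) where
  "(\<rhd>) = bilin_ext act"

text \<open>
  The free Lie algebra on the set of trees, realised as the Lie subalgebra generated by the trees
  in its enveloping algebra.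
\<close>

inductive_set lie_OT :: "(forest \<Rightarrow>\<^sub>0 'k::field_char_0) set" where
  tree: "basis [t] \<in> lie_OT"
| zero: "0 \<in> lie_OT"
| add: "x \<in> lie_OT \<Longrightarrow> y \<in> lie_OT \<Longrightarrow> x + y \<in> lie_OT"
| scale: "x \<in> lie_OT \<Longrightarrow> c *\<^sub>k x \<in> lie_OT"
| bracket: "x \<in> lie_OT \<Longrightarrow> y \<in> lie_OT \<Longrightarrow> x \<cdot> y - y \<cdot> x \<in> lie_OT"


section \<open>The dual side\<close>

text \<open>
  \<open>forest \<Rightarrow>\<^sub>0 'k\<close> is also the graded dual, with \<open>basis w\<close> now denoting the dual basis.
\<close>

fun shuffle_words :: "forest \<Rightarrow> forest \<Rightarrow> forest list" where
  "shuffle_words [] v = [v]"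
| "shuffle_words u [] = [u]"
| "shuffle_words (s # u) (t # v) =
     map (\<lambda>w. s # w) (shuffle_words u (t # v)) @ map (\<lambda>w. t # w) (shuffle_words (s # u) v)"

definition shuffle :: "(forest \<Rightarrow>\<^sub>0 'k) \<Rightarrow> (forest \<Rightarrow>\<^sub>0 'k) \<Rightarrow> (forest \<Rightarrow>\<^sub>0 'k::field_char_0)"
    (infixl \<open>\<squnion>\<close> 70) where
  "(\<squnion>) = bilin_ext (\<lambda>u v. sum_words (shuffle_words u v))"

definition deconc :: "(forest \<Rightarrow>\<^sub>0 'k) \<Rightarrow> (forest \<times> forest \<Rightarrow>\<^sub>0 'k::field_char_0)" where
  "deconc = lin_ext (\<lambda>w. \<Sum>i\<le>length w. basis (take i w, drop i w))"

text \<open>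
  The dual of \<open>\<rhd>\<close>: the coefficient of \<open>basis (A, B)\<close> in the image of \<open>basis w\<close> is the coefficient
  of \<open>w\<close> in \<open>A \<rhd> B\<close>. The lemmas below show that only finitely many of these are nonzero.
\<close>

definition dual_tri :: "(forest \<Rightarrow>\<^sub>0 'k) \<Rightarrow> (forest \<times> forest \<Rightarrow>\<^sub>0 'k::field_char_0)" where
  "dual_tri = lin_ext (\<lambda>w. Abs_poly_mapping (\<lambda>(A, B). lookup (act A B) w))"

lemma lookup_scale [simp]: "lookup (c *\<^sub>k x) a = c * lookup x a"
  unfolding scale_def by (simp add: map.rep_eq when_def)

lemma keys_basis [simp]: "keys (basis a :: 'a \<Rightarrow>\<^sub>0 'k::field_char_0) = {a}"
  unfolding basis_def by simp

lemma keys_scale: "keys (c *\<^sub>k x) \<subseteq> keys x"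
  by (auto simp: in_keys_iff)

lemma keys_sum_subset: "keys (sum f S) \<subseteq> (\<Union>a\<in>S. keys (f a))"
proof
  fix b assume "b \<in> keys (sum f S)"
  then have "(\<Sum>a\<in>S. lookup (f a) b) \<noteq> 0" by (simp add: in_keys_iff lookup_sum)
  then obtain a where "a \<in> S" "lookup (f a) b \<noteq> 0" by (meson sum.not_neutral_contains_not_neutral)
  then show "b \<in> (\<Union>a\<in>S. keys (f a))" by (auto simp: in_keys_iff)
qed

lemma keys_lin_extE:
  assumes "b \<in> keys (lin_ext f x)"
  obtains a where "a \<in> keys x" "b \<in> keys (f a)"
proof -
  from subsetD[OF keys_sum_subset assms[unfolded lin_ext_def]]
  obtain a where a: "a \<in> keys x" and b: "b \<in> keys (lookup x a *\<^sub>k f a)" by (rule UN_E)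
  from b keys_scale have "b \<in> keys (f a)" by (rule subsetD[rotated])
  with a show thesis by (rule that)
qed

lemma keys_bilin_extE:
  fixes x :: "'a \<Rightarrow>\<^sub>0 'd::field_char_0"
  assumes "c \<in> keys (bilin_ext f x y)"
  obtains a b where "a \<in> keys x" "b \<in> keys y" "c \<in> keys (f a b)"
proof -
  obtain p where p: "p \<in> keys (x \<otimes> y)" and c: "c \<in> keys (case p of (a, b) \<Rightarrow> f a b)"
    using assms unfolding bilin_ext_def by (rule keys_lin_extE)
  from p obtain a where a: "a \<in> keys x" and p': "p \<in> keys (lin_ext (\<lambda>b. basis (a, b)) y :: _ \<Rightarrow>\<^sub>0 'd)"
    unfolding tensor_def by (rule keys_lin_extE)
  from p' obtain b where b: "b \<in> keys y" and "p \<in> keys (basis (a, b) :: _ \<Rightarrow>\<^sub>0 'd)"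
    by (rule keys_lin_extE)
  then have "p = (a, b)" by simp
  with a b c that show thesis by simp
qed

lemma keys_sum_list: "keys (sum_list xs) \<subseteq> (\<Union>x\<in>set xs. keys x)"
proof (induction xs)
  case (Cons x xs)
  then show ?case using keys_add[of x "sum_list xs"] by auto
qed simp

lemma deg_simps [simp]:
  "deg [] = 0" "deg (t # F) = vertices t + deg F" "deg (F @ G) = deg F + deg G"
  by (auto simp: deg_def)

lemma vertices_Node [simp]: "vertices (Node F) = Suc (deg F)"
  by (simp add: deg_def)

declare vertices.simps [simp del]

lemma deg_graft:
  "s' \<in> set (graft t s) \<Longrightarrow> vertices s' = vertices t + vertices s"
  "F' \<in> set (graft_forest t F) \<Longrightarrow> deg F' = vertices t + deg F"
  by (induction t s and t F arbitrary: s' and F' rule: graft_graft_forest.induct) auto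

lemma deg_conc:
  assumes "\<And>u. u \<in> keys x \<Longrightarrow> deg u = m" "\<And>v. v \<in> keys y \<Longrightarrow> deg v = n" "w \<in> keys (x \<cdot> y)"
  shows "deg w = m + n"
  using assms(3) unfolding conc_def by (elim keys_bilin_extE) (auto simp: assms(1,2))

lemma deg_act_tree:
  "w \<in> keys (act_tree A s :: forest \<Rightarrow>\<^sub>0 'k::field_char_0) \<Longrightarrow> deg w = deg A + vertices s"
proof (induction A s arbitrary: w rule: act_tree.induct)
  case (2 t A s)
  let ?X = "lin_ext (\<lambda>B. sum_words (graft_forest t B)) (act_tree A s) :: forest \<Rightarrow>\<^sub>0 'k"
  let ?Y = "(\<Sum>A'\<leftarrow>graft_forest t A. act_tree A' s) :: forest \<Rightarrow>\<^sub>0 'k"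
  have "w \<in> keys ?X \<or> w \<in> keys ?Y"
    using "2.prems" by (auto simp: in_keys_iff lookup_minus)
  then show ?case
  proof
    assume "w \<in> keys ?X"
    then obtain B where B: "B \<in> keys (act_tree A s :: forest \<Rightarrow>\<^sub>0 'k)"
        and "w \<in> keys (sum_words (graft_forest t B) :: forest \<Rightarrow>\<^sub>0 'k)"
      by (rule keys_lin_extE)
    then have "w \<in> set (graft_forest t B)"
      using keys_sum_list[of "map basis (graft_forest t B) :: (forest \<Rightarrow>\<^sub>0 'k) list"]
      by (auto simp: sum_words_def)
    with "2.IH"(1)[OF B] show ?thesis by (auto dest: deg_graft)
  next
    assume "w \<in> keys ?Y"
    then obtain A' where A': "A' \<in> set (graft_forest t A)"
        and w: "w \<in> keys (act_tree A' s :: forest \<Rightarrow>\<^sub>0 'k)"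
      using keys_sum_list[of "map (\<lambda>A'. act_tree A' s) (graft_forest t A) :: (forest \<Rightarrow>\<^sub>0 'k) list"]
      by auto
    from "2.IH"(2)[OF A' w] A' show ?thesis by (auto dest: deg_graft)
  qed
qed simp

lemma deg_unshuffle: "(B, C) \<in> set (unshuffle A) \<Longrightarrow> deg A = deg B + deg C"
  by (induction A arbitrary: B C) auto

lemma deg_act: "w \<in> keys (act A B :: forest \<Rightarrow>\<^sub>0 'k::field_char_0) \<Longrightarrow> deg w = deg A + deg B"
proof (induction A B arbitrary: w rule: act.induct)
  case (2 A s D)
  let ?f = "\<lambda>(A1, A2). act_tree A1 s \<cdot> act A2 D :: forest \<Rightarrow>\<^sub>0 'k"
  from "2.prems" obtain A1 A2 where A: "(A1, A2) \<in> set (unshuffle A)"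
      and w: "w \<in> keys (?f (A1, A2))"
    using keys_sum_list[of "map ?f (unshuffle A)"] by auto
  have "deg w = (deg A1 + vertices s) + (deg A2 + deg D)"
  proof (rule deg_conc)
    show "deg u = deg A1 + vertices s" if "u \<in> keys (act_tree A1 s :: forest \<Rightarrow>\<^sub>0 'k)" for u
      using that by (rule deg_act_tree)
    show "deg v = deg A2 + deg D" if "v \<in> keys (act A2 D :: forest \<Rightarrow>\<^sub>0 'k)" for v
      using "2.IH"[OF A refl that] .
    show "w \<in> keys (act_tree A1 s \<cdot> act A2 D :: forest \<Rightarrow>\<^sub>0 'k)"
      using w by simp
  qed
  with deg_unshuffle[OF A] show ?case by simp
qed (auto split: if_splits)

lemma finite_deg_le: "finite {F. deg F \<le> n}"
proof (induction n)
  case 0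
  have "F = []" if "deg F \<le> 0" for F
    using that by (cases F rule: list.exhaust; cases "hd F") auto
  then have "{F. deg F \<le> 0} \<subseteq> {[]}" by auto
  then show ?case by (rule finite_subset) simp
next
  case (Suc n)
  let ?S = "{F. deg F \<le> n}"
  have "{F. deg F \<le> Suc n} \<subseteq> insert [] ((\<lambda>(F, G). Node F # G) ` (?S \<times> ?S))"
  proof
    fix F assume "F \<in> {F. deg F \<le> Suc n}"
    then show "F \<in> insert [] ((\<lambda>(F, G). Node F # G) ` (?S \<times> ?S))"
      by (cases F rule: list.exhaust; cases "hd F") (auto simp: image_iff)
  qed
  then show ?case by (rule finite_subset) (simp add: Suc)
qed

lemma finite_dual_tri: "finite {AB. (case AB of (A, B) \<Rightarrow> lookup (act A B :: forest \<Rightarrow>\<^sub>0 'k::field_char_0) w) \<noteq> 0}"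
proof (rule finite_subset)
  show "{AB. (case AB of (A, B) \<Rightarrow> lookup (act A B :: forest \<Rightarrow>\<^sub>0 'k) w) \<noteq> 0}
      \<subseteq> {F. deg F \<le> deg w} \<times> {F. deg F \<le> deg w}"
  proof safe
    fix A B assume "lookup (act A B :: forest \<Rightarrow>\<^sub>0 'k) w \<noteq> 0"
    then have "w \<in> keys (act A B :: forest \<Rightarrow>\<^sub>0 'k)" by (simp add: in_keys_iff)
    then have "deg w = deg A + deg B" by (rule deg_act)
    then show "deg A \<le> deg w" "deg B \<le> deg w" by simp_all
  qed
qed (simp add: finite_deg_le)

lemma lookup_dual_tri:
  "lookup (dual_tri (basis w)) (A, B) = lookup (act A B :: forest \<Rightarrow>\<^sub>0 'k::field_char_0) w"
  unfolding dual_tri_def lin_ext_def keys_basis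
  by (simp add: basis_def finite_dual_tri)

definition J :: "(forest \<Rightarrow>\<^sub>0 'k) \<Rightarrow> (forest \<Rightarrow>\<^sub>0 'k::field_char_0)" where
  "J x = x - lookup x [] *\<^sub>k basis []"

definition convolution ::
    "((forest \<Rightarrow>\<^sub>0 'k) \<Rightarrow> (forest \<Rightarrow>\<^sub>0 'k)) \<Rightarrow> ((forest \<Rightarrow>\<^sub>0 'k) \<Rightarrow> (forest \<Rightarrow>\<^sub>0 'k))
      \<Rightarrow> (forest \<Rightarrow>\<^sub>0 'k) \<Rightarrow> (forest \<Rightarrow>\<^sub>0 'k::field_char_0)" where
  "convolution f g x = lin_ext (\<lambda>(u, v). f (basis u) \<squnion> g (basis v)) (deconc x)"

primrec J_power :: "nat \<Rightarrow> (forest \<Rightarrow>\<^sub>0 'k) \<Rightarrow> (forest \<Rightarrow>\<^sub>0 'k::field_char_0)" where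
  "J_power 0 = (\<lambda>x. lookup x [] *\<^sub>k basis [])"
| "J_power (Suc n) = convolution J (J_power n)"

text \<open>The series is finite on each word, because \<open>J_power n\<close> vanishes on words shorter than \<open>n\<close>.\<close>

definition euler_idem :: "(forest \<Rightarrow>\<^sub>0 'k) \<Rightarrow> (forest \<Rightarrow>\<^sub>0 'k::field_char_0)" where
  "euler_idem = lin_ext (\<lambda>w. \<Sum>n=1..length w. ((-1) ^ (n + 1) / of_nat n) *\<^sub>k J_power n (basis w))"


section \<open>Completions\<close>

text \<open>
  Every degree contains finitely many forests, so the completed tensor algebra consists of all
  functions \<open>forest \<Rightarrow> 'k\<close>; \<open>lookup\<close> embeds the tensor algebra into it. A series belongs to the
  completion of \<open>lie_OT\<close> iff all its homogeneous components belong to \<open>lie_OT\<close>.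
\<close>

definition lie_hat :: "(forest \<Rightarrow> 'k::field_char_0) set" where
  "lie_hat = {p. \<forall>n. \<exists>x\<in>lie_OT. \<forall>w. lookup x w = (if deg w = n then p w else 0)}"

definition conc_hat :: "(forest \<Rightarrow> 'k) \<Rightarrow> (forest \<Rightarrow> 'k) \<Rightarrow> (forest \<Rightarrow> 'k::field_char_0)" where
  "conc_hat A B w = pairing (\<lambda>(u, v). A u * B v) (deconc (basis w))"

definition tri_hat :: "(forest \<Rightarrow> 'k) \<Rightarrow> (forest \<Rightarrow> 'k) \<Rightarrow> (forest \<Rightarrow> 'k::field_char_0)" where
  "tri_hat A B w = pairing (\<lambda>(u, v). A u * B v) (dual_tri (basis w))"

primrec power_hat :: "(forest \<Rightarrow> 'k) \<Rightarrow> nat \<Rightarrow> (forest \<Rightarrow> 'k::field_char_0)" where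
  "power_hat p 0 = lookup (basis [])"
| "power_hat p (Suc n) = conc_hat p (power_hat p n)"

text \<open>
  The exponential of a series without constant term: the \<open>n\<close>-th power has no coefficient at words
  shorter than \<open>n\<close>.
\<close>

definition exp_hat :: "(forest \<Rightarrow> 'k) \<Rightarrow> (forest \<Rightarrow> 'k::field_char_0)" where
  "exp_hat p w = (\<Sum>n\<le>length w. power_hat p n w / fact n)"

text \<open>
  Continuity at zero for the topology defined by the degree filtration, which for linear maps
  amounts to continuity.
\<close>

definition continuous_hat :: "((forest \<Rightarrow> 'k::field_char_0) \<Rightarrow> (forest \<Rightarrow> 'k)) \<Rightarrow> bool" where
  "continuous_hat a \<longleftrightarrow>
     (\<forall>n. \<exists>m. \<forall>A. (\<forall>w. deg w < m \<longrightarrow> A w = 0) \<longrightarrow> (\<forall>w. deg w < n \<longrightarrow> a A w = 0))"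

definition algebra_endo_hat :: "((forest \<Rightarrow> 'k::field_char_0) \<Rightarrow> (forest \<Rightarrow> 'k)) \<Rightarrow> bool" where
  "algebra_endo_hat a \<longleftrightarrow>
     (\<forall>c A B. a (\<lambda>w. c * A w + B w) = (\<lambda>w. c * a A w + a B w)) \<and>
     a (lookup (basis [])) = lookup (basis []) \<and>
     (\<forall>A B. a (conc_hat A B) = conc_hat (a A) (a B))"

text \<open>
  A map satisfying \<open>algebra_endo_hat\<close> preserves commutators, so compatibility with the bracket need
  not be required again.
\<close>

definition restricts_to_post_lie_endo :: "((forest \<Rightarrow> 'k::field_char_0) \<Rightarrow> (forest \<Rightarrow> 'k)) \<Rightarrow> bool" where
  "restricts_to_post_lie_endo a \<longleftrightarrow>
     (\<forall>x\<in>lie_hat. a x \<in> lie_hat) \<and>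
     (\<forall>x\<in>lie_hat. \<forall>y\<in>lie_hat. a (tri_hat x y) = tri_hat (a x) (a y))"

definition subst_endo :: "(forest \<Rightarrow> 'k) \<Rightarrow> (forest \<Rightarrow> 'k) \<Rightarrow> (forest \<Rightarrow> 'k::field_char_0)" where
  "subst_endo p = (THE a. algebra_endo_hat a \<and> continuous_hat a \<and> restricts_to_post_lie_endo a \<and>
     a (lookup (basis [bullet])) = p)"


section \<open>Co-substitution\<close>

definition cosubst :: "(forest \<Rightarrow>\<^sub>0 'k) \<Rightarrow> (forest \<times> forest \<Rightarrow>\<^sub>0 'k::field_char_0)" where
  "cosubst = (THE D. Vector_Spaces.linear (*\<^sub>k) (*\<^sub>k) D \<and>
     (\<forall>p\<in>lie_hat. \<forall>A x. pairing (subst_endo p (lookup A)) x =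
        pairing (\<lambda>(u, v). exp_hat p u * lookup A v) (D x)))"

definition map_second ::
    "((forest \<Rightarrow>\<^sub>0 'k) \<Rightarrow> (forest \<Rightarrow>\<^sub>0 'k)) \<Rightarrow> (forest \<times> forest \<Rightarrow>\<^sub>0 'k) \<Rightarrow> (forest \<times> forest \<Rightarrow>\<^sub>0 'k::field_char_0)" where
  "map_second f = lin_ext (\<lambda>(u, v). basis u \<otimes> f (basis v))"

definition proj_trees :: "(forest \<Rightarrow>\<^sub>0 'k) \<Rightarrow> (forest \<Rightarrow>\<^sub>0 'k::field_char_0)" where
  "proj_trees = lin_ext (\<lambda>w. if length w = 1 then basis w else 0)"

definition Bplus :: "(forest \<Rightarrow>\<^sub>0 'k) \<Rightarrow> (forest \<Rightarrow>\<^sub>0 'k::field_char_0)" where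
  "Bplus = lin_ext (\<lambda>w. basis [Node w])"

definition U_star :: "(forest \<Rightarrow>\<^sub>0 'k) \<Rightarrow> (forest \<times> forest \<Rightarrow>\<^sub>0 'k::field_char_0)" where
  "U_star x = map_second proj_trees (cosubst x)"

definition shuffle13_conc24 ::
    "((forest \<times> forest) \<times> (forest \<times> forest) \<Rightarrow>\<^sub>0 'k) \<Rightarrow> (forest \<times> forest \<Rightarrow>\<^sub>0 'k::field_char_0)" where
  "shuffle13_conc24 = lin_ext (\<lambda>((w1, w2), (w3, w4)).
     (basis w1 \<squnion> basis w3) \<otimes> (basis w2 \<cdot> basis w4))"

definition shuffle135_conc24 ::
    "((forest \<times> forest) \<times> (forest \<times> forest) \<times> forest \<Rightarrow>\<^sub>0 'k) \<Rightarrow> (forest \<times> forest \<Rightarrow>\<^sub>0 'k::field_char_0)" where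
  "shuffle135_conc24 = lin_ext (\<lambda>((w1, w2), (w3, w4), w5).
     (basis w1 \<squnion> basis w3 \<squnion> basis w5) \<otimes> (basis w2 \<cdot> basis w4))"

text \<open>
  Sweedler sums: \<open>sweedler f y\<close> is the sum of \<open>f y' y''\<close> over the terms \<open>y' \<otimes> y''\<close> of \<open>y\<close>, for
  bilinear \<open>f\<close>.
\<close>

definition sweedler ::
    "((forest \<Rightarrow>\<^sub>0 'k) \<Rightarrow> (forest \<Rightarrow>\<^sub>0 'k) \<Rightarrow> ('c \<Rightarrow>\<^sub>0 'k)) \<Rightarrow> (forest \<times> forest \<Rightarrow>\<^sub>0 'k) \<Rightarrow> ('c \<Rightarrow>\<^sub>0 'k::field_char_0)" where
  "sweedler f = lin_ext (\<lambda>(u, v). f (basis u) (basis v))"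

end

theory Submission
  imports Defs "HOL-Library.Product_Plus" "HOL-Computational_Algebra.Polynomial"
    "HOL-Computational_Algebra.Formal_Power_Series"
begin

text \<open>
  An element of \<open>T\<degree>(OT) \<otimes> T(OT)\<close> is determined by its pairings with \<open>exp(p) \<otimes> A\<close>, for \<open>p\<close> a Lie
  series and \<open>A\<close> a word, because the powers of Lie elements span the tensor algebra. Under these
  pairings the recursion says that \<open>a\<^sub>p(A s) = a\<^sub>p(A) a\<^sub>p(s)\<close> for a tree \<open>s\<close>: shuffles become products
  because \<open>exp(p)\<close> is a character, and \<open>s = B\<^sup>+(B) = B \<rhd> \<bullet>\<close> gives \<open>a\<^sub>p(s) = a\<^sub>p(B) \<rhd> p\<close>, where the
  coordinates of \<open>p = log(exp(p))\<close> are pairings of \<open>exp(p)\<close> with the values of the Euler idempotent.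
\<close>


section \<open>Linear extension\<close>

text \<open>\<open>subst_endo\<close> and \<open>cosubst\<close> are definite descriptions, so
  existence and uniqueness must be settled before either can be computed. For a_p the obstacle is
  that compatibility with \<rhd> is demanded between Lie series only, whereas the formula for a_p on
  trees involves a_p(B) for arbitrary forests B. This forces the rules for \<rhd> to be proved on
  the whole tensor algebra with any Lie element, not just a tree, as left factor. For
  co-substitution, existence means that every coefficient of a_p(A) is a polynomial in the
  coordinates of \<open>p\<close>: the Euler idempotent represents the coordinates and shuffles
  represent their products. Characteristic zero enters through exponential and logarithm, through
  the infinitely many scalars that make a polynomial vanish, and through division by the number of
  equal terms in the spanning argument.\<close>

lemma scale_simps [simp]:
  "0 *\<^sub>k x = 0" "1 *\<^sub>k x = x" "c *\<^sub>k 0 = 0" "c *\<^sub>k d *\<^sub>k x = (c * d) *\<^sub>k x"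
  "c *\<^sub>k (- x) = - (c *\<^sub>k x)" "(- c) *\<^sub>k x = - (c *\<^sub>k x)"
  by (auto intro!: poly_mapping_eqI)

lemma scale_add_right: "c *\<^sub>k (x + y) = c *\<^sub>k x + c *\<^sub>k y"
  and scale_add_left: "(c + d) *\<^sub>k x = c *\<^sub>k x + d *\<^sub>k x"
  and scale_diff_right: "c *\<^sub>k (x - y) = c *\<^sub>k x - c *\<^sub>k y"
  by (auto intro!: poly_mapping_eqI simp: lookup_add lookup_minus algebra_simps)

lemma vector_space_scale: "vector_space ((*\<^sub>k) :: 'k::field_char_0 \<Rightarrow> ('a \<Rightarrow>\<^sub>0 'k) \<Rightarrow> _)"
  by unfold_locales (simp_all add: scale_add_right scale_add_left)

lemma scale_sum: "c *\<^sub>k sum f S = (\<Sum>a\<in>S. c *\<^sub>k f a)"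
  by (induction S rule: infinite_finite_induct) (auto simp: scale_add_right)

lemma lookup_basis: "lookup (basis a) b = (if a = b then 1 else 0)"
  by (simp add: basis_def lookup_single when_def)

lemma lookup_sum_list: "lookup (sum_list (map f xs)) b = (\<Sum>a\<leftarrow>xs. lookup (f a) b)"
  by (induction xs) (auto simp: lookup_add)

lemma single_induct [case_names single add]:
  fixes x :: "'a \<Rightarrow>\<^sub>0 'b::comm_monoid_add"
  assumes "\<And>a c. P (Poly_Mapping.single a c)" "\<And>x y. P x \<Longrightarrow> P y \<Longrightarrow> P (x + y)"
  shows "P x"
proof -
  have P0: "P 0" using assms(1)[of undefined 0] by simp
  have "P (\<Sum>a\<in>S. Poly_Mapping.single a (lookup x a))" if "finite S" for S
    using that by (induction S rule: finite_induct) (simp_all add: assms P0)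
  moreover have "(\<Sum>a\<in>keys x. Poly_Mapping.single a (lookup x a)) = x"
    by (rule poly_mapping_eqI) (simp add: lookup_sum lookup_single when_def in_keys_iff)
  ultimately show ?thesis using finite_keys by metis
qed

text \<open>Multilinear identities are reduced to words with this rule, one argument at a
  time.\<close>

lemma basis_induct [case_names basis scale add zero]:
  fixes x :: "'a \<Rightarrow>\<^sub>0 'k::field_char_0"
  assumes "\<And>a. P (basis a)" "\<And>c x. P x \<Longrightarrow> P (c *\<^sub>k x)" "\<And>x y. P x \<Longrightarrow> P y \<Longrightarrow> P (x + y)" "P 0"
  shows "P x"
proof (induction x rule: single_induct)
  case (single a c)
  have "Poly_Mapping.single a c = c *\<^sub>k basis a"
    by (rule poly_mapping_eqI) (simp add: lookup_basis lookup_single when_def)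
  then show ?case using assms by simp
qed (use assms in simp)

lemma pairing_superset:
  assumes "finite S" "keys x \<subseteq> S"
  shows "pairing A x = (\<Sum>a\<in>S. A a * lookup x a)"
  unfolding pairing_def by (rule sum.mono_neutral_left) (use assms in \<open>auto simp: in_keys_iff\<close>)

lemma pairing_zero [simp]: "pairing A 0 = 0"
  by (simp add: pairing_def)

lemma pairing_add [simp]: "pairing A (x + y) = pairing A x + pairing A y"
proof -
  let ?S = "keys x \<union> keys y"
  have "pairing A (x + y) = (\<Sum>a\<in>?S. A a * lookup (x + y) a)"
    by (rule pairing_superset) (use keys_add[of x y] in auto)
  also have "\<dots> = (\<Sum>a\<in>?S. A a * lookup x a) + (\<Sum>a\<in>?S. A a * lookup y a)"
    by (simp add: lookup_add algebra_simps sum.distrib)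
  also have "\<dots> = pairing A x + pairing A y"
    by (simp add: pairing_superset[symmetric])
  finally show ?thesis .
qed

lemma pairing_scale [simp]: "pairing A (c *\<^sub>k x) = c * pairing A x"
proof -
  have "pairing A (c *\<^sub>k x) = (\<Sum>a\<in>keys x. A a * lookup (c *\<^sub>k x) a)"
    by (rule pairing_superset) (simp_all add: keys_scale)
  then show ?thesis by (simp add: pairing_def sum_distrib_left algebra_simps)
qed

lemma pairing_basis [simp]: "pairing A (basis a) = A a"
  by (simp add: pairing_def lookup_basis)

lemma pairing_minus [simp]: "pairing A (- x) = - pairing A x"
  using pairing_scale[of A "-1" x] by (simp del: pairing_scale)

lemma pairing_diff [simp]: "pairing A (x - y) = pairing A x - pairing A y"
  using pairing_add[of A x "-y"] by (simp del: pairing_add)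

lemma pairing_sum: "pairing A (sum f S) = (\<Sum>a\<in>S. pairing A (f a))"
  by (induction S rule: infinite_finite_induct) auto

lemma pairing_sum_list: "pairing A (sum_list (map f xs)) = (\<Sum>a\<leftarrow>xs. pairing A (f a))"
  by (induction xs) auto

lemma pairing_fun_add: "pairing (\<lambda>a. A a + B a) x = pairing A x + pairing B x"
  and pairing_fun_mult: "pairing (\<lambda>a. c * A a) x = c * pairing A x"
  by (simp_all add: pairing_def sum.distrib sum_distrib_left algebra_simps)

lemma pairing_fun_zero [simp]: "pairing (\<lambda>a. 0) x = 0"
  by (simp add: pairing_def)

lemma pairing_fun_sum: "pairing (\<lambda>a. \<Sum>i\<in>I. A i a) x = (\<Sum>i\<in>I. pairing (A i) x)"
  unfolding pairing_def sum_distrib_right by (rule sum.swap)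

lemma pairing_cong: "(\<And>a. a \<in> keys x \<Longrightarrow> A a = B a) \<Longrightarrow> pairing A x = pairing B x"
  by (simp add: pairing_def)

lemma pairing_lookup_basis [simp]: "pairing (lookup (basis a)) x = lookup x a"
  by (induction x rule: basis_induct) (auto simp: lookup_basis lookup_add)

lemma lookup_lin_ext: "lookup (lin_ext f x) b = pairing (\<lambda>a. lookup (f a) b) x"
  by (simp add: lin_ext_def pairing_def lookup_sum mult.commute)

lemma lin_ext_simps [simp]:
  "lin_ext f 0 = 0" "lin_ext f (basis a) = f a" "lin_ext f (x + y) = lin_ext f x + lin_ext f y"
  "lin_ext f (c *\<^sub>k x) = c *\<^sub>k lin_ext f x" "lin_ext f (x - y) = lin_ext f x - lin_ext f y"
  "lin_ext f (- x) = - lin_ext f x"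
  by (auto intro!: poly_mapping_eqI simp: lookup_lin_ext lookup_add lookup_minus)

lemma lin_ext_sum: "lin_ext f (sum g S) = (\<Sum>a\<in>S. lin_ext f (g a))"
  by (induction S rule: infinite_finite_induct) auto

lemma lin_ext_sum_list: "lin_ext f (sum_list (map g xs)) = (\<Sum>a\<leftarrow>xs. lin_ext f (g a))"
  by (induction xs) auto

lemma pairing_lin_ext: "pairing A (lin_ext f x) = pairing (\<lambda>a. pairing A (f a)) x"
  by (induction x rule: basis_induct) auto

lemma lin_ext_fun_add: "lin_ext (\<lambda>a. f a + g a) x = lin_ext f x + lin_ext g x"
  and lin_ext_fun_scale: "lin_ext (\<lambda>a. c *\<^sub>k f a) x = c *\<^sub>k lin_ext f x"
  by (auto intro!: poly_mapping_eqI
      simp: lookup_lin_ext lookup_add pairing_fun_add pairing_fun_mult)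

lemma lin_ext_fun_zero [simp]: "lin_ext (\<lambda>a. 0) x = 0"
  by (simp add: lin_ext_def)

lemma lookup_tensor: "lookup (x \<otimes> y) (a, b) = lookup x a * lookup y b"
proof -
  have "pairing (\<lambda>b'. lookup (basis (a', b')) (a, b)) y = (if a' = a then lookup y b else 0)" for a'
    by (induction y rule: basis_induct) (auto simp: lookup_basis lookup_add)
  then show ?thesis
    unfolding tensor_def lookup_lin_ext
    by (induction x rule: basis_induct) (auto simp: lookup_basis lookup_add algebra_simps)
qed

lemma tensor_simps [simp]:
  "0 \<otimes> y = 0" "x \<otimes> 0 = 0" "basis a \<otimes> basis b = basis (a, b)"
  "c *\<^sub>k x \<otimes> y = c *\<^sub>k (x \<otimes> y)" "x \<otimes> c *\<^sub>k y = c *\<^sub>k (x \<otimes> y)"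
  by (auto intro!: poly_mapping_eqI simp: lookup_tensor lookup_basis)

lemma tensor_distribs:
  "(x + x') \<otimes> y = (x \<otimes> y) + (x' \<otimes> y)" "x \<otimes> (y + y') = (x \<otimes> y) + (x \<otimes> y')"
  "(x - x') \<otimes> y = (x \<otimes> y) - (x' \<otimes> y)" "x \<otimes> (y - y') = (x \<otimes> y) - (x \<otimes> y')"
  by (auto intro!: poly_mapping_eqI
      simp: lookup_tensor lookup_add lookup_minus algebra_simps)

lemma pairing_tensor: "pairing (\<lambda>(a, b). A a * B b) (x \<otimes> y) = pairing A x * pairing B y"
proof (induction x rule: basis_induct)
  case (basis a)
  show ?case by (induction y rule: basis_induct) (auto simp: tensor_distribs algebra_simps)
qed (auto simp: tensor_distribs algebra_simps)

lemma bilin_ext_simps [simp]: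
  "bilin_ext f 0 y = 0" "bilin_ext f x 0 = 0" "bilin_ext f (basis a) (basis b) = f a b"
  "bilin_ext f (c *\<^sub>k x) y = c *\<^sub>k bilin_ext f x y" "bilin_ext f x (c *\<^sub>k y) = c *\<^sub>k bilin_ext f x y"
  "bilin_ext f (x + x') y = bilin_ext f x y + bilin_ext f x' y"
  "bilin_ext f x (y + y') = bilin_ext f x y + bilin_ext f x y'"
  "bilin_ext f (x - x') y = bilin_ext f x y - bilin_ext f x' y"
  "bilin_ext f x (y - y') = bilin_ext f x y - bilin_ext f x y'"
  by (simp_all add: bilin_ext_def tensor_distribs)


section \<open>Tensor algebras as rings\<close>

text \<open>Multiplication of finitely supported functions is convolution over the additive monoid
  of keys. With words as that monoid the tensor algebra becomes a ring under concatenation, and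
  pairs of words give its tensor square, so powers and ring laws are at hand.\<close>

instantiation list :: (type) monoid_add
begin
definition zero_list :: "'a list" where "zero_list = []"
definition plus_list :: "'a list \<Rightarrow> 'a list \<Rightarrow> 'a list" where "plus_list = (@)"
instance by standard (auto simp: zero_list_def plus_list_def)
end

lemma basis_times: "basis a * basis b = (basis (a + b) :: 'a::monoid_add \<Rightarrow>\<^sub>0 'k::field_char_0)"
  by (simp add: basis_def mult_single)

text \<open>Scalars embed as multiples of the unit, which are central although the ring is not
  commutative. The two forms move a scalar out of either factor.\<close>

lemma scale_eq_times:
  fixes x :: "'a::monoid_add \<Rightarrow>\<^sub>0 'k::field_char_0"
  shows "c *\<^sub>k x = Poly_Mapping.single 0 c * x" and "c *\<^sub>k x = x * Poly_Mapping.single 0 c"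
proof -
  have *: "c *\<^sub>k Poly_Mapping.single a d = Poly_Mapping.single a (c * d)" for a :: 'a and d :: 'k
    by (rule poly_mapping_eqI) (simp add: lookup_single when_def)
  show "c *\<^sub>k x = Poly_Mapping.single 0 c * x"
  proof (induction x rule: single_induct)
    case (single a d)
    show ?case by (simp only: * mult_single add_0_left)
  next
    case (add x y)
    then show ?case by (simp only: scale_add_right distrib_left)
  qed
  show "c *\<^sub>k x = x * Poly_Mapping.single 0 c"
  proof (induction x rule: single_induct)
    case (single a d)
    show ?case by (simp only: * mult_single add_0_right mult.commute[of c d])
  next
    case (add x y)
    then show ?case by (simp only: scale_add_right distrib_right)
  qed
qed

lemma scale_times [simp]:
  fixes x :: "'a::monoid_add \<Rightarrow>\<^sub>0 'k::field_char_0"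
  shows "(c *\<^sub>k x) * y = c *\<^sub>k (x * y)" "x * (c *\<^sub>k y) = c *\<^sub>k (x * y)"
  by (simp only: scale_eq_times(1) mult.assoc, simp only: scale_eq_times(2) mult.assoc)

lemma one_eq_basis: "1 = basis []"
  by (metis basis_def single_one zero_list_def)

lemma basis_Nil [simp]: "basis [] = 1"
  by (simp add: one_eq_basis)

lemma lookup_1: "lookup (1 :: 'a list \<Rightarrow>\<^sub>0 'k::field_char_0) w = (if w = [] then 1 else 0)"
  by (simp add: one_eq_basis lookup_basis del: basis_Nil)

lemma basis_append: "basis (u @ v) = basis u * basis v"
  by (simp add: basis_times plus_list_def)

lemma basis_Cons: "basis (t # v) = basis [t] * basis v"
  using basis_append[of "[t]" v] by simp

lemma conc_eq_times: "x \<cdot> y = x * y"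
proof (induction x rule: basis_induct)
  case (basis a)
  show ?case
    by (induction y rule: basis_induct) (auto simp: conc_def basis_append algebra_simps)
qed (auto simp: conc_def algebra_simps)

text \<open>Concatenation is dual to deconcatenation: among the cuts of \<open>w\<close> only the
  one after \<open>length u\<close> letters can return the pair \<open>(u, v)\<close>.\<close>

lemma lookup_times: "lookup (x * y) w = (\<Sum>i\<le>length w. lookup x (take i w) * lookup y (drop i w))"
  for x y :: "'a list \<Rightarrow>\<^sub>0 'k::field_char_0"
proof (induction x rule: basis_induct)
  case (basis u)
  show ?case
  proof (induction y rule: basis_induct)
    case (basis v)
    have "(\<Sum>i\<le>length w. lookup (basis u) (take i w) * lookup (basis v) (drop i w)) =
        (\<Sum>i\<le>length w. if i = length u then if w = u @ v then 1 else 0 else 0 :: 'k)"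
    proof (rule sum.cong, goal_cases)
      case (2 i)
      then have "u = take i w \<and> v = drop i w \<longleftrightarrow> i = length u \<and> w = u @ v"
        by (metis append_eq_conv_conj append_take_drop_id atMost_iff length_take min.absorb2)
      moreover have "lookup (basis u) (take i w) * lookup (basis v) (drop i w) =
          (if u = take i w \<and> v = drop i w then 1 else 0 :: 'k)"
        by (simp only: lookup_basis) simp
      moreover have "(if P \<and> Q then 1 else 0) = (if P then if Q then 1 else 0 else 0 :: 'k)" for P Q
        by simp
      ultimately show ?case by (simp only:)
    qed simp
    also have "\<dots> = (if w = u @ v then 1 else 0)"
      by (cases "w = u @ v") (simp_all only: if_True if_False, simp_all)
    also have "\<dots> = lookup (basis (u @ v)) w" by (simp add: lookup_basis eq_commute[of w])
    finally show ?case by (simp add: basis_append)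
  qed (auto simp: lookup_add algebra_simps sum.distrib sum_distrib_left)
qed (auto simp: lookup_add algebra_simps sum.distrib sum_distrib_left)

lemma one_tensor_one: "1 \<otimes> 1 = (1 :: forest \<times> forest \<Rightarrow>\<^sub>0 'k::field_char_0)"
  by (metis basis_Nil basis_def single_one tensor_simps(3) zero_list_def zero_prod_def)

lemma tensor_times: "(x \<otimes> y) * (x' \<otimes> y') = (x * x') \<otimes> (y * y')"
  for x y x' y' :: "forest \<Rightarrow>\<^sub>0 'k::field_char_0"
proof (induction x rule: basis_induct)
  case (basis a)
  show ?case
  proof (induction y rule: basis_induct)
    case (basis b)
    show ?case
    proof (induction x' rule: basis_induct)
      case (basis c)
      show ?case
        by (induction y' rule: basis_induct) (auto simp: basis_times tensor_distribs algebra_simps)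
    qed (auto simp: tensor_distribs algebra_simps)
  qed (auto simp: tensor_distribs algebra_simps)
qed (auto simp: tensor_distribs algebra_simps)


section \<open>The coproduct and the post-Lie product\<close>

lemma sum_list_swap:
  "(\<Sum>x\<leftarrow>xs. \<Sum>y\<leftarrow>ys. g x y :: 'b::comm_monoid_add) = (\<Sum>y\<leftarrow>ys. \<Sum>x\<leftarrow>xs. g x y)"
  by (induction xs) (simp_all add: sum_list_addf)

text \<open>Coassociativity, tested against an arbitrary \<open>f\<close> instead of being stated in
  a triple tensor product. The head \<open>t\<close> lands in one of three factors, which gives the
  three instances of the induction hypothesis.\<close>

lemma sum_unshuffle_coassoc:
  fixes f :: "forest \<Rightarrow> forest \<Rightarrow> forest \<Rightarrow> 'b::comm_monoid_add"
  shows "(\<Sum>(A1, A2)\<leftarrow>unshuffle A. \<Sum>(B, C)\<leftarrow>unshuffle A2. f A1 B C) =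
    (\<Sum>(A1, A2)\<leftarrow>unshuffle A. \<Sum>(B, C)\<leftarrow>unshuffle A1. f B C A2)"
proof (induction A arbitrary: f)
  case (Cons t A)
  from Cons[of "\<lambda>A. f (t # A)"] Cons[of "\<lambda>A1 B. f A1 (t # B)"] Cons[of "\<lambda>A1 B C. f A1 B (t # C)"]
  show ?case by (simp add: case_prod_unfold comp_def sum_list_addf ac_simps)
qed simp

lemma sum_unshuffle_counit:
  fixes f :: "forest \<Rightarrow> 'b::comm_monoid_add"
  shows "(\<Sum>(B, C)\<leftarrow>unshuffle A. if B = [] then f C else 0) = f A"
  by (induction A arbitrary: f) (simp_all add: case_prod_unfold comp_def cong: if_cong)

text \<open>Grafting a tree is a coderivation of the coproduct: it changes one letter, and that
  letter lies in exactly one of the two parts.\<close>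

lemma sum_unshuffle_graft:
  fixes f :: "forest \<Rightarrow> forest \<Rightarrow> 'b::comm_monoid_add"
  shows "(\<Sum>F'\<leftarrow>graft_forest t F. \<Sum>(B, C)\<leftarrow>unshuffle F'. f B C) =
    (\<Sum>(B, C)\<leftarrow>unshuffle F. (\<Sum>B'\<leftarrow>graft_forest t B. f B' C) + (\<Sum>C'\<leftarrow>graft_forest t C. f B C'))"
proof (induction F arbitrary: f)
  case (Cons s F)
  have swap: "(\<Sum>x\<leftarrow>graft t s. \<Sum>y\<leftarrow>unshuffle F. g x y) = (\<Sum>y\<leftarrow>unshuffle F. \<Sum>x\<leftarrow>graft t s. g x y)"
    for g :: "tree \<Rightarrow> forest \<times> forest \<Rightarrow> 'b"
    by (rule sum_list_swap)
  from Cons[of "\<lambda>B. f (s # B)"] Cons[of "\<lambda>B C. f B (s # C)"]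
  show ?case by (simp add: case_prod_unfold comp_def sum_list_addf swap ac_simps)
qed simp

section \<open>The action of words on words\<close>

lemma tri_basis [simp]: "basis A \<rhd> basis F = act A F"
  by (simp add: tri_def del: basis_Nil)

lemma tri_simps [simp]:
  "0 \<rhd> y = 0" "x \<rhd> 0 = 0" "(c *\<^sub>k x) \<rhd> y = c *\<^sub>k (x \<rhd> y)" "x \<rhd> (c *\<^sub>k y) = c *\<^sub>k (x \<rhd> y)"
  by (simp_all add: tri_def)

lemma tri_distribs:
  "(x + x') \<rhd> y = (x \<rhd> y) + (x' \<rhd> y)" "x \<rhd> (y + y') = (x \<rhd> y) + (x \<rhd> y')"
  "(x - x') \<rhd> y = (x \<rhd> y) - (x' \<rhd> y)" "x \<rhd> (y - y') = (x \<rhd> y) - (x \<rhd> y')"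
  by (simp_all add: tri_def)

lemma tri_sum_list:
  "sum_list (map f xs) \<rhd> y = (\<Sum>x\<leftarrow>xs. f x \<rhd> y)" "z \<rhd> sum_list (map f xs) = (\<Sum>x\<leftarrow>xs. z \<rhd> f x)"
  by (induction xs) (simp_all add: tri_distribs)

lemma tri_sum_words:
  "sum_words ws \<rhd> y = (\<Sum>w\<leftarrow>ws. basis w \<rhd> y)"
  by (simp add: sum_words_def tri_sum_list)

declare act.simps [simp del]

lemma act_Nil: "act A [] = (if A = [] then 1 else 0)"
  by (simp add: act.simps)

lemma act_Cons: "act A (s # D) = (\<Sum>(A1, A2)\<leftarrow>unshuffle A. act_tree A1 s * act A2 D)"
  by (simp add: act.simps conc_eq_times)

lemma act_empty [simp]: "act [] F = basis F"
proof (induction F)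
  case (Cons s F)
  then show ?case by (simp add: act_Cons flip: basis_Cons)
qed (simp add: act_Nil)

lemma one_tri [simp]: "1 \<rhd> y = y"
  by (induction y rule: basis_induct) (simp_all add: one_eq_basis tri_distribs del: basis_Nil)

text \<open>The definition of \<open>act\<close> splits off a single tree; coassociativity regroups
  these splittings at an arbitrary place.\<close>

lemma act_append:
  "act A (F @ G) = (\<Sum>(B, C)\<leftarrow>unshuffle A. act B F * act C G :: _ \<Rightarrow>\<^sub>0 'k::field_char_0)"
proof (induction F arbitrary: A)
  case Nil
  have "(\<Sum>(B, C)\<leftarrow>unshuffle A. act B [] * act C G :: _ \<Rightarrow>\<^sub>0 'k) = (\<Sum>(B, C)\<leftarrow>unshuffle A. if B = [] then act C G else 0)"
    unfolding act_Nil by (intro arg_cong[of _ _ sum_list] map_cong) auto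
  then show ?case by (simp add: sum_unshuffle_counit)
next
  case (Cons s F)
  have "(act A ((s # F) @ G) :: _ \<Rightarrow>\<^sub>0 'k) = (\<Sum>(A1, A2)\<leftarrow>unshuffle A. \<Sum>(B, C)\<leftarrow>unshuffle A2. act_tree A1 s * act B F * act C G)"
    by (simp add: act_Cons Cons case_prod_unfold mult.assoc sum_list_const_mult)
  also have "\<dots> = (\<Sum>(A1, A2)\<leftarrow>unshuffle A. \<Sum>(B, C)\<leftarrow>unshuffle A1. act_tree B s * act C F * act A2 G)"
    by (rule sum_unshuffle_coassoc)
  finally show ?case
    by (simp add: act_Cons case_prod_unfold sum_list_mult_const)
qed

lemma act_tree_graft: "act [t] F = (sum_words (graft_forest t F) :: _ \<Rightarrow>\<^sub>0 'k::field_char_0)"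
proof (induction F)
  case (Cons s F)
  have "(act [t] (s # F) :: _ \<Rightarrow>\<^sub>0 'k) = sum_words (graft_forest t [s]) * basis F + basis [s] * act [t] F"
    by (simp add: act_Cons)
  also have "\<dots> = sum_words (graft_forest t (s # F))"
    by (simp add: Cons[unfolded sum_words_def] sum_words_def comp_def
        flip: basis_Cons sum_list_mult_const sum_list_const_mult)
  finally show ?case .
qed (simp add: act_Nil sum_words_def)

lemma lin_ext_graft: "lin_ext (\<lambda>B. sum_words (graft_forest t B)) x = basis [t] \<rhd> x"
  by (induction x rule: basis_induct) (simp_all add: act_tree_graft tri_distribs del: basis_Nil)

lemma tree_tri_times: "basis [t] \<rhd> (x * y) = (basis [t] \<rhd> x) * y + x * (basis [t] \<rhd> y)"
proof (induction x rule: basis_induct)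
  case (basis F)
  show ?case
  proof (induction y rule: basis_induct)
    case (basis G)
    show ?case by (simp add: act_append flip: basis_append)
  qed (auto simp: tri_distribs scale_add_right algebra_simps)
qed (auto simp: tri_distribs scale_add_right algebra_simps)

text \<open>The definition imposes this rule only on single trees. It passes to words because
  \<open>t\<close> acts as a derivation and the correction terms distribute over the two factors by
  \<open>sum_unshuffle_graft\<close>.\<close>

lemma act_Cons_left:
  "act (t # A) F =
    (basis [t] \<rhd> act A F) - (\<Sum>A'\<leftarrow>graft_forest t A. act A' F :: _ \<Rightarrow>\<^sub>0 'k::field_char_0)"
proof (induction F arbitrary: A)
  case Nil
  \<comment> \<open>Grafting preserves the number of letters, so no \<open>A'\<close> is the empty
    word.\<close>
  have "act A' [] = (0 :: _ \<Rightarrow>\<^sub>0 'k)" if "A' \<in> set (graft_forest t A)" for A'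
    using that length_graft_forest[OF that] by (cases A) (auto simp: act_Nil)
  then have "(\<Sum>A'\<leftarrow>graft_forest t A. act A' []) = (0 :: _ \<Rightarrow>\<^sub>0 'k)"
    by (simp cong: map_cong)
  moreover have "basis [t] \<rhd> (1 :: _ \<Rightarrow>\<^sub>0 'k) = 0"
    unfolding one_eq_basis by (simp del: basis_Nil add: act_Nil)
  ultimately show ?case by (simp add: act_Nil)
next
  case (Cons s F)
  have "(\<Sum>A'\<leftarrow>graft_forest t A. act A' (s # F) :: _ \<Rightarrow>\<^sub>0 'k) = (\<Sum>(B, C)\<leftarrow>unshuffle A.
      (\<Sum>B'\<leftarrow>graft_forest t B. act_tree B' s * act C F) + (\<Sum>C'\<leftarrow>graft_forest t C. act_tree B s * act C' F))"
    unfolding act_Cons by (rule sum_unshuffle_graft)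
  then show ?case
    by (simp add: act_Cons Cons lin_ext_graft case_prod_unfold comp_def tri_sum_list tree_tri_times
        sum_list_addf sum_list_subtractf sum_list_const_mult sum_list_mult_const algebra_simps)
qed

lemma tree_times_tri:
  fixes x :: "forest \<Rightarrow>\<^sub>0 'k::field_char_0"
  shows "(basis [t] * x) \<rhd> y = (basis [t] \<rhd> (x \<rhd> y)) - ((basis [t] \<rhd> x) \<rhd> y)"
proof (induction x rule: basis_induct)
  case (basis A)
  show ?case
  proof (induction y rule: basis_induct)
    case (basis F)
    have "sum_words (graft_forest t A) \<rhd> basis F = (\<Sum>A'\<leftarrow>graft_forest t A. act A' F :: _ \<Rightarrow>\<^sub>0 'k)"
      by (simp add: sum_words_def tri_sum_list del: basis_Nil)
    then show ?case
      by (simp add: act_Cons_left[of t A F] act_tree_graft flip: basis_Cons)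
  qed (auto simp: tri_distribs scale_diff_right)
next
  case (scale c x)
  then show ?case by (simp add: scale_diff_right)
qed (simp_all add: tri_distribs distrib_left)

section \<open>The coproduct as a ring homomorphism\<close>

definition coproduct :: "(forest \<Rightarrow>\<^sub>0 'k) \<Rightarrow> (forest \<times> forest \<Rightarrow>\<^sub>0 'k::field_char_0)" where
  "coproduct = lin_ext (\<lambda>A. sum_words (unshuffle A))"

lemma coproduct_simps [simp]:
  "coproduct 0 = 0" "coproduct (x + y) = coproduct x + coproduct y"
  "coproduct (x - y) = coproduct x - coproduct y" "coproduct (c *\<^sub>k x) = c *\<^sub>k coproduct x"
  "coproduct (basis A) = sum_words (unshuffle A)"
  by (simp_all add: coproduct_def del: basis_Nil)

lemma coproduct_one [simp]: "coproduct 1 = 1"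
  unfolding one_eq_basis by (simp add: sum_words_def one_tensor_one flip: tensor_simps(3) del: basis_Nil)
    (simp add: one_tensor_one)

lemma coproduct_basis_Cons:
  "coproduct (basis (t # A)) =
    ((basis [t] \<otimes> 1) + (1 \<otimes> basis [t])) * (coproduct (basis A) :: _ \<Rightarrow>\<^sub>0 'k::field_char_0)"
proof -
  have "(\<Sum>x\<leftarrow>unshuffle A. basis (t # fst x, snd x)) = (basis [t] \<otimes> 1) * (\<Sum>x\<leftarrow>unshuffle A. basis x :: _ \<Rightarrow>\<^sub>0 'k)"
    "(\<Sum>x\<leftarrow>unshuffle A. basis (fst x, t # snd x)) = (1 \<otimes> basis [t]) * (\<Sum>x\<leftarrow>unshuffle A. basis x :: _ \<Rightarrow>\<^sub>0 'k)"
    unfolding one_eq_basis tensor_simps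
    by (simp_all add: basis_times plus_prod_def plus_list_def flip: sum_list_const_mult del: basis_Nil)
  then show ?thesis by (simp add: sum_words_def case_prod_unfold comp_def distrib_right)
qed

lemma coproduct_times: "coproduct (x * y) = coproduct x * coproduct y"
proof (induction x rule: basis_induct)
  case (basis A)
  show ?case
  proof (induction y rule: basis_induct)
    case (basis B)
    show ?case
      by (induction A)
        (simp_all add: basis_append[symmetric] coproduct_basis_Cons mult.assoc del: coproduct_simps(5))
  qed (auto simp: algebra_simps)
qed (auto simp: algebra_simps)

lemma tri_times_coproduct:
  "x \<rhd> (y * z) = lin_ext (\<lambda>(A, B). (basis A \<rhd> y) * (basis B \<rhd> z)) (coproduct x)"
proof (induction x rule: basis_induct)
  case (basis A)
  show ?case
  proof (induction y rule: basis_induct)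
    case (basis F)
    show ?case
    proof (induction z rule: basis_induct)
      case (basis G)
      show ?case
        by (simp add: act_append lin_ext_sum_list sum_words_def flip: basis_append)
    qed (simp_all add: tri_distribs distrib_left case_prod_unfold lin_ext_fun_add lin_ext_fun_scale)
  qed (simp_all add: tri_distribs distrib_right case_prod_unfold lin_ext_fun_add lin_ext_fun_scale)
qed (simp_all add: tri_distribs)

text \<open>The product that turns iterated application of \<rhd> into a single one. For primitive
  \<open>x\<close> it is \<open>x * y + (x \<rhd> y)\<close>, which is how the post-Lie rules for
  Lie elements are reached.\<close>

definition grossman_larson :: "(forest \<Rightarrow>\<^sub>0 'k) \<Rightarrow> (forest \<Rightarrow>\<^sub>0 'k) \<Rightarrow> (forest \<Rightarrow>\<^sub>0 'k::field_char_0)" where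
  "grossman_larson x y = lin_ext (\<lambda>(A, B). basis A * (basis B \<rhd> y)) (coproduct x)"

lemma grossman_larson_basis: "grossman_larson (basis A) y = (\<Sum>(B, C)\<leftarrow>unshuffle A. basis B * (basis C \<rhd> y))"
  by (simp add: grossman_larson_def sum_words_def lin_ext_sum_list)

text \<open>The letter \<open>t\<close> goes to one of the two factors of the coproduct. On the
  right, \<open>tree_times_tri\<close> expands its action, and the leftover terms are those of
  grafting \<open>t\<close> into \<open>A\<close>, by the coderivation property.\<close>

lemma grossman_larson_graft:
  "grossman_larson (basis (t # A)) y =
     (basis [t] * grossman_larson (basis A) y) + (basis [t] \<rhd> grossman_larson (basis A) y)
      - (\<Sum>A'\<leftarrow>graft_forest t A. grossman_larson (basis A') y)"
proof -
  have "(\<Sum>A'\<leftarrow>graft_forest t A. grossman_larson (basis A') y) = (\<Sum>(B, C)\<leftarrow>unshuffle A.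
      (\<Sum>B'\<leftarrow>graft_forest t B. basis B' * (basis C \<rhd> y)) + (\<Sum>C'\<leftarrow>graft_forest t C. basis B * (basis C' \<rhd> y)))"
    unfolding grossman_larson_basis by (rule sum_unshuffle_graft)
  moreover have "(\<Sum>C'\<leftarrow>graft_forest t C. basis B * (basis C' \<rhd> y)) = basis B * ((basis [t] \<rhd> basis C) \<rhd> y)"
    "(\<Sum>B'\<leftarrow>graft_forest t B. basis B' * (basis C \<rhd> y)) = (basis [t] \<rhd> basis B) * (basis C \<rhd> y)" for B C
    by (simp_all add: act_tree_graft sum_words_def tri_sum_list sum_list_const_mult sum_list_mult_const)
  moreover have "basis [t] \<rhd> (basis C \<rhd> y) = ((basis [t] * basis C) \<rhd> y) + ((basis [t] \<rhd> basis C) \<rhd> y)" for C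
    by (simp add: tree_times_tri)
  ultimately show ?thesis
    by (simp add: grossman_larson_basis case_prod_unfold comp_def tri_sum_list tree_tri_times sum_list_addf
        basis_Cons[of t "fst p" for p] basis_Cons[of t "snd p" for p] distrib_left mult.assoc sum_list_const_mult del: tri_basis)
qed

text \<open>The induction is on the length of the acting word: the correction words in
  \<open>graft_forest t A'\<close> are not subwords of \<open>A'\<close>, but they have the same
  length.\<close>

lemma tri_tri: "x \<rhd> (y \<rhd> z) = grossman_larson x y \<rhd> z"
proof -
  have "basis A \<rhd> (y \<rhd> z) = grossman_larson (basis A) y \<rhd> z" for A
  proof (induction "length A" arbitrary: A)
    case 0
    then show ?case using grossman_larson_basis[of "[]" y] by simp
  next
    case (Suc n)
    then obtain t A' where A: "A = t # A'" "length A' = n" by (cases A) auto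
    then have "basis A \<rhd> (y \<rhd> z) = (basis [t] \<rhd> (grossman_larson (basis A') y \<rhd> z)) - ((basis [t] \<rhd> basis A') \<rhd> (y \<rhd> z))"
      using Suc by (simp add: basis_Cons[of t A'] tree_times_tri del: tri_basis)
    also have "(basis [t] \<rhd> basis A') \<rhd> (y \<rhd> z) = (\<Sum>A''\<leftarrow>graft_forest t A'. grossman_larson (basis A'') y \<rhd> z)"
    proof -
      have "basis A'' \<rhd> (y \<rhd> z) = grossman_larson (basis A'') y \<rhd> z" if "A'' \<in> set (graft_forest t A')" for A''
        using Suc(1) A length_graft_forest[OF that] by simp
      then show ?thesis
        unfolding tri_basis[of "[t]"] act_tree_graft tri_sum_words by (intro arg_cong[of _ _ sum_list] map_cong) auto
    qed
    finally show ?case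
      by (simp add: A grossman_larson_graft tri_distribs tree_times_tri tri_sum_list)
  qed
  then show ?thesis
    by (induction x rule: basis_induct) (simp_all add: grossman_larson_def tri_distribs)
qed


section \<open>Lie elements\<close>

lemma lie_sum_list: "(\<And>x. x \<in> set xs \<Longrightarrow> f x \<in> lie_OT) \<Longrightarrow> sum_list (map f xs) \<in> lie_OT"
  by (induction xs) (auto intro: lie_OT.intros)

lemma lie_sum: "(\<And>x. x \<in> S \<Longrightarrow> f x \<in> lie_OT) \<Longrightarrow> sum f S \<in> lie_OT"
  by (induction S rule: infinite_finite_induct) (auto intro: lie_OT.intros)

lemma lie_diff: "x \<in> lie_OT \<Longrightarrow> y \<in> lie_OT \<Longrightarrow> x - y \<in> lie_OT"
  using lie_OT.add[OF _ lie_OT.scale[of y "-1"], of x] by simp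

lemma lie_bracket: "x \<in> lie_OT \<Longrightarrow> y \<in> lie_OT \<Longrightarrow> x * y - y * x \<in> lie_OT"
  using lie_OT.bracket[of x y] by (simp add: conc_eq_times)

text \<open>In a commutator of primitive elements the mixed terms \<open>x \<otimes> y\<close> and
  \<open>y \<otimes> x\<close> cancel.\<close>

lemma lie_primitive:
  assumes "x \<in> lie_OT"
  shows "coproduct x = (x \<otimes> 1) + (1 \<otimes> x)"
  using assms
proof induction
  case (tree t)
  show ?case unfolding one_eq_basis by (simp add: sum_words_def del: basis_Nil)
next
  case (bracket x y)
  then show ?case
    by (simp add: conc_eq_times coproduct_times tensor_times tensor_distribs algebra_simps)
qed (simp_all add: tensor_distribs scale_add_right)

lemma lie_tri_times:
  assumes "x \<in> lie_OT"
  shows "x \<rhd> (y * z) = (x \<rhd> y) * z + y * (x \<rhd> z)"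
proof -
  have "lin_ext (\<lambda>(A, B). (basis A \<rhd> y) * (basis B \<rhd> z)) (a \<otimes> b) = (a \<rhd> y) * (b \<rhd> z)" for a b
  proof (induction a rule: basis_induct)
    case (basis A)
    show ?case
      by (induction b rule: basis_induct) (simp_all add: tensor_distribs tri_distribs distrib_left)
  qed (simp_all add: tensor_distribs tri_distribs distrib_right)
  then show ?thesis by (simp add: tri_times_coproduct lie_primitive[OF assms])
qed

lemma lie_tri_one: "x \<in> lie_OT \<Longrightarrow> x \<rhd> 1 = 0"
  using lie_tri_times[of x 1 1] by simp

text \<open>The defining rule for a tree as left factor, now for any Lie element. It is
  \<open>tri_tri\<close> read through primitivity of \<open>x\<close>.\<close>

lemma lie_times_tri:
  assumes "x \<in> lie_OT"
  shows "(x * y) \<rhd> z = (x \<rhd> (y \<rhd> z)) - ((x \<rhd> y) \<rhd> z)"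
proof -
  have "lin_ext (\<lambda>(A, B). basis A * (basis B \<rhd> y)) (a \<otimes> b) = a * (b \<rhd> y)" for a b
  proof (induction a rule: basis_induct)
    case (basis A)
    show ?case
      by (induction b rule: basis_induct) (simp_all add: tensor_distribs tri_distribs distrib_left)
  qed (simp_all add: tensor_distribs tri_distribs distrib_right)
  then have "grossman_larson x y = x * y + (x \<rhd> y)"
    by (simp add: grossman_larson_def lie_primitive[OF assms])
  then show ?thesis by (simp add: tri_tri tri_distribs)
qed

text \<open>The left argument is an arbitrary element, because a_p(B) \<rhd> p has to be a Lie
  series for every forest B. Trees act as derivations, hence preserve brackets; longer words follow
  by induction on length.\<close>

lemma tri_lie:
  assumes "x \<in> lie_OT"
  shows "y \<rhd> x \<in> lie_OT"
proof -
  have tree: "basis [t] \<rhd> x \<in> lie_OT" if "x \<in> lie_OT" for t and x :: "_ \<Rightarrow>\<^sub>0 'a"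
    using that
  proof induction
    case (tree s)
    show ?case by (auto simp: act_tree_graft sum_words_def intro!: lie_sum_list lie_OT.tree)
  next
    case (bracket x y)
    have "basis [t] \<rhd> (x * y - y * x) =
        ((basis [t] \<rhd> x) * y - y * (basis [t] \<rhd> x)) + (x * (basis [t] \<rhd> y) - (basis [t] \<rhd> y) * x)"
      by (simp add: tri_distribs tree_tri_times del: tri_basis)
    then show ?case
      using bracket by (simp add: conc_eq_times lie_OT.add lie_bracket)
  qed (simp_all add: tri_distribs lie_OT.intros)
  have "basis A \<rhd> x \<in> lie_OT" for A
  proof (induction "length A" arbitrary: A)
    case (Suc n)
    then obtain t A' where A: "A = t # A'" "length A' = n" by (cases A) auto
    have "(basis [t] \<rhd> basis A') \<rhd> x = (\<Sum>A''\<leftarrow>graft_forest t A'. basis A'' \<rhd> x)"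
      by (simp add: act_tree_graft tri_sum_words)
    then have "(basis [t] \<rhd> basis A') \<rhd> x \<in> lie_OT"
      using Suc A by (auto intro!: lie_sum_list simp: length_graft_forest simp del: tri_basis)
    moreover have "basis A \<rhd> x = (basis [t] \<rhd> (basis A' \<rhd> x)) - ((basis [t] \<rhd> basis A') \<rhd> x)"
      unfolding A basis_Cons[of t A'] by (rule tree_times_tri)
    ultimately show ?case using tree Suc A by (simp add: lie_diff del: tri_basis)
  qed (simp add: assms)
  then show ?thesis
    by (induction y rule: basis_induct) (simp_all add: tri_distribs lie_OT.intros)
qed

text \<open>The linear coefficient in \<open>c\<close> inserts one \<open>y\<close> among the
  factors \<open>x\<close>. The prefix \<open>a\<close> is carried along because factors are peeled
  off on the left, and the constant coefficient is what the branch that has already used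
  \<open>y\<close> contributes.\<close>

lemma pairing_power_poly:
  fixes x y :: "forest \<Rightarrow>\<^sub>0 'k::field_char_0"
  shows "\<exists>Q. (\<forall>c. pairing B (a * (x + c *\<^sub>k y) ^ m) = poly Q c) \<and>
    coeff Q 1 = pairing B (a * (\<Sum>i<m. x ^ i * y * x ^ (m - 1 - i))) \<and> coeff Q 0 = pairing B (a * x ^ m)"
proof (induction m arbitrary: a)
  case 0
  show ?case by (rule exI[of _ "[:pairing B a:]"]) simp
next
  case (Suc m)
  from Suc[of "a * x"] Suc[of "a * y"] obtain Q R where
    Q: "\<And>c. pairing B (a * x * (x + c *\<^sub>k y) ^ m) = poly Q c"
      "coeff Q 1 = pairing B (a * x * (\<Sum>i<m. x ^ i * y * x ^ (m - 1 - i)))" "coeff Q 0 = pairing B (a * x * x ^ m)"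
    and R: "\<And>c. pairing B (a * y * (x + c *\<^sub>k y) ^ m) = poly R c" "coeff R 0 = pairing B (a * y * x ^ m)"
    by metis
  have "x * (\<Sum>i<m. x ^ i * y * x ^ (m - 1 - i)) + y * x ^ m = (\<Sum>i<Suc m. x ^ i * y * x ^ (m - i))"
    unfolding sum.lessThan_Suc_shift by (simp add: sum_distrib_left mult.assoc add.commute)
  then have "coeff (Q + pCons 0 R) 1 = pairing B (a * (\<Sum>i<Suc m. x ^ i * y * x ^ (Suc m - 1 - i)))"
    using Q(2) R(2) by (simp add: mult.assoc flip: distrib_left pairing_add)
  moreover have "pairing B (a * (x + c *\<^sub>k y) ^ Suc m) = poly (Q + pCons 0 R) c" for c
    by (simp add: Q(1)[symmetric] R(1)[symmetric] distrib_left distrib_right mult.assoc)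
  ultimately show ?case
    using Q(3) by (intro exI[of _ "Q + pCons 0 R"]) (simp add: mult.assoc)
qed

text \<open>
  The powers of Lie elements span the tensor algebra: the coefficient of \<open>c\<close> in \<open>(x + c z)^(n+1)\<close>
  is the sum of the \<open>x^j z x^(n-j)\<close>, and these agree up to terms \<open>x^j [x,z] x^(n-1-j)\<close>.
\<close>

lemma pairing_lie_powers_eq_0:
  fixes B :: "forest \<Rightarrow> 'k::field_char_0"
  assumes B: "\<And>x n. x \<in> lie_OT \<Longrightarrow> pairing B (x ^ n) = 0"
  shows "B w = 0"
  using B
proof (induction w arbitrary: B)
  case Nil
  from Nil[OF lie_OT.zero, of 0] show ?case by (simp flip: basis_Nil)
next
  case (Cons t w)
  have sum0: "pairing B (\<Sum>i<Suc n. x ^ i * z * x ^ (n - i)) = 0" if "x \<in> lie_OT" "z \<in> lie_OT" for x z n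
  proof -
    obtain Q where Q: "\<forall>c. pairing B (1 * (x + c *\<^sub>k z) ^ Suc n) = poly Q c"
        "coeff Q 1 = pairing B (1 * (\<Sum>i<Suc n. x ^ i * z * x ^ (Suc n - 1 - i)))"
      using pairing_power_poly[of B 1 x z "Suc n"] by (elim exE conjE) (rule that)
    \<comment> \<open>\<open>x + c *\<^sub>k z\<close> is again Lie, so the hypothesis kills the
      polynomial at every scalar.\<close>
    have "poly Q c = 0" for c
      unfolding Q(1)[rule_format, symmetric] using Cons.prems[of "x + c *\<^sub>k z" "Suc n"] that by (simp add: lie_OT.intros)
    then have "Q = 0" by (simp flip: poly_all_0_iff_0)
    with Q(2) show ?thesis by simp
  qed
  have ins: "pairing B (x ^ j * z * x ^ (n - j)) = 0" if "x \<in> lie_OT" "z \<in> lie_OT" "j \<le> n" for x z n j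
    using that
  proof (induction n arbitrary: j z)
    case 0
    with sum0[of x z 0] show ?case by simp
  next
    case (Suc n)
    have step: "pairing B (x ^ Suc i * z * x ^ (n - i)) = pairing B (x ^ i * z * x ^ (Suc n - i))" if "i \<le> n" for i
    proof -
      have "x ^ Suc i * z * x ^ (n - i) - x ^ i * z * x ^ (Suc n - i) = x ^ i * (x * z - z * x) * x ^ (n - i)"
        unfolding Suc_diff_le[OF that] power_Suc2[of x i] power_Suc[of x "n - i"]
        by (simp only: left_diff_distrib right_diff_distrib mult.assoc)
      moreover have "pairing B (x ^ i * (x * z - z * x) * x ^ (n - i)) = 0"
        using Suc that by (simp add: lie_bracket)
      ultimately show ?thesis
        by (subst eq_iff_diff_eq_0, subst pairing_diff[symmetric]) (simp only:)
    qed
    have const: "pairing B (x ^ i * z * x ^ (Suc n - i)) = pairing B (z * x ^ Suc n)" if "i \<le> Suc n" for i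
      using that by (induction i) (use step in auto)
    \<comment> \<open>All \<open>Suc (Suc n)\<close> summands are equal and add up to zero, so each
      vanishes in characteristic zero.\<close>
    have "0 = pairing B (\<Sum>i<Suc (Suc n). x ^ i * z * x ^ (Suc n - i))"
      using sum0[of x z "Suc n"] Suc.prems by simp
    also have "\<dots> = (\<Sum>i<Suc (Suc n). pairing B (z * x ^ Suc n))"
      unfolding pairing_sum by (rule sum.cong) (use const in auto)
    also have "\<dots> = of_nat (Suc (Suc n)) * pairing B (z * x ^ Suc n)" by simp
    finally have "pairing B (z * x ^ Suc n) = 0" by (metis mult_eq_0_iff of_nat_eq_0_iff nat.distinct(1))
    with const Suc.prems show ?case by simp
  qed
  \<comment> \<open>The functional that first prefixes \<open>t\<close> kills all powers as well, by
    \<open>ins\<close> with \<open>z = basis [t]\<close> and \<open>j = 0\<close>; this strips the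
    first letter of the word.\<close>
  have shift: "pairing (\<lambda>w. B (t # w)) y = pairing B (basis [t] * y)" for y
    by (induction y rule: basis_induct) (simp_all add: distrib_left flip: basis_Cons)
  have "pairing (\<lambda>w. B (t # w)) (x ^ n) = 0" if "x \<in> lie_OT" for x n
    unfolding shift using ins[of x "basis [t]" 0 n] that by (simp add: lie_OT.tree)
  then show ?case by (rule Cons.IH)
qed


section \<open>Completions\<close>

text \<open>Both products respect the degree, so an identity of series follows once, for every
  \<open>N\<close>, both sides share a finite approximation.\<close>

definition approx :: "nat \<Rightarrow> (forest \<Rightarrow> 'k) \<Rightarrow> (forest \<Rightarrow>\<^sub>0 'k::field_char_0) \<Rightarrow> bool" where
  "approx N A a \<longleftrightarrow> (\<forall>w. deg w \<le> N \<longrightarrow> A w = lookup a w)"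

lemma approxD: "approx N A a \<Longrightarrow> deg w \<le> N \<Longrightarrow> A w = lookup a w"
  by (simp add: approx_def)

lemma hat_eqI:
  assumes "\<And>N. \<exists>l. approx N A l \<and> approx N B l"
  shows "A = B"
proof
  fix w
  from assms[of "deg w"] show "A w = B w" by (auto simp: approx_def)
qed

lemma ex_approx: "\<exists>a. approx N A a"
proof -
  have "lookup (\<Sum>w | deg w \<le> N. A w *\<^sub>k basis w) w = A w" if "deg w \<le> N" for w
    using that by (simp add: lookup_sum lookup_basis finite_deg_le if_distrib cong: if_cong)
  then show ?thesis unfolding approx_def by metis
qed

lemma approx_lookup [simp]: "approx N (lookup a) a"
  by (simp add: approx_def)

lemma approx_linear:
  assumes "approx N A a" "approx N B b"
  shows "approx N (\<lambda>w. A w + B w) (a + b)" "approx N (\<lambda>w. A w - B w) (a - b)" "approx N (\<lambda>w. c * A w) (c *\<^sub>k a)"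
  using assms by (simp_all add: approx_def lookup_add lookup_minus)

lemma deg_take_drop: "deg (take i w) + deg (drop i w) = deg w"
  by (simp flip: deg_simps(3))

lemma deg_take_le: "deg (take i w) \<le> deg w" and deg_drop_le: "deg (drop i w) \<le> deg w"
  using deg_take_drop[of i w] by simp_all

lemma deconc_basis: "deconc (basis w) = (\<Sum>i\<le>length w. basis (take i w, drop i w))"
  by (simp add: deconc_def del: basis_Nil)

lemma conc_hat_eq: "conc_hat A B w = (\<Sum>i\<le>length w. A (take i w) * B (drop i w))"
  by (simp add: conc_hat_def deconc_basis pairing_sum)

lemma approx_conc:
  assumes "approx N A a" "approx N B b"
  shows "approx N (conc_hat A B) (a * b)"
  unfolding approx_def
proof safe
  fix w :: forest assume "deg w \<le> N"
  then have "deg (take i w) \<le> N" "deg (drop i w) \<le> N" for i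
    using deg_take_le[of i w] deg_drop_le[of i w] by simp_all
  then show "conc_hat A B w = lookup (a * b) w"
    using assms by (simp add: conc_hat_eq lookup_times approx_def)
qed

lemma dual_tri_degree:
  assumes "(u, v) \<in> keys (dual_tri (basis w) :: _ \<Rightarrow>\<^sub>0 'k::field_char_0)"
  shows "deg w = deg u + deg v"
proof -
  from assms have "w \<in> keys (act u v :: _ \<Rightarrow>\<^sub>0 'k)" by (simp add: in_keys_iff lookup_dual_tri del: basis_Nil)
  then show ?thesis by (rule deg_act)
qed

lemma tri_hat_lookup: "tri_hat (lookup x) (lookup y) = lookup (x \<rhd> y)"
proof
  fix w
  show "tri_hat (lookup x) (lookup y) w = lookup (x \<rhd> y) w"
    unfolding tri_hat_def case_prod_unfold
  proof (induction x rule: basis_induct)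
    case (basis a)
    show ?case
    proof (induction y rule: basis_induct)
      case (basis b)
      have "(\<lambda>p. lookup (basis a) (fst p) * lookup (basis b) (snd p)) = (lookup (basis (a, b)) :: _ \<Rightarrow> 'a)"
        by (auto simp: lookup_basis simp del: basis_Nil)
      then show ?case by (simp add: lookup_dual_tri del: basis_Nil)
    qed (simp_all add: lookup_add tri_distribs distrib_left pairing_fun_add pairing_fun_mult
        mult.left_commute del: tri_basis basis_Nil)
  qed (simp_all add: lookup_add tri_distribs distrib_right pairing_fun_add pairing_fun_mult
      mult.assoc del: tri_basis basis_Nil)
qed

lemma approx_tri:
  assumes "approx N A a" "approx N B b"
  shows "approx N (tri_hat A B) (a \<rhd> b)"
  unfolding approx_def
proof safe
  fix w :: forest assume "deg w \<le> N"
  then have "tri_hat A B w = tri_hat (lookup a) (lookup b) w"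
    unfolding tri_hat_def using assms
    by (intro pairing_cong) (auto simp: approx_def dest!: dual_tri_degree)
  then show "tri_hat A B w = lookup (a \<rhd> b) w" by (simp add: tri_hat_lookup)
qed

lemma conc_hat_assoc: "conc_hat (conc_hat A B) C = conc_hat A (conc_hat B C)"
proof (rule hat_eqI)
  fix N
  obtain a b c where "approx N A a" "approx N B b" "approx N C c" by (metis ex_approx)
  then have "approx N (conc_hat (conc_hat A B) C) (a * b * c)" "approx N (conc_hat A (conc_hat B C)) (a * (b * c))"
    by (simp_all add: approx_conc)
  then show "\<exists>l. approx N (conc_hat (conc_hat A B) C) l \<and> approx N (conc_hat A (conc_hat B C)) l"
    by (metis mult.assoc)
qed

lemma conc_hat_one [simp]:
  "conc_hat (lookup 1) A = A" "conc_hat A (lookup 1) = A"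
proof -
  show "conc_hat (lookup 1) A = A"
    by (rule hat_eqI) (metis approx_conc approx_lookup ex_approx mult_1)
  show "conc_hat A (lookup 1) = A"
    by (rule hat_eqI) (metis approx_conc approx_lookup ex_approx mult_1_right)
qed

lemma conc_hat_add_left: "conc_hat (\<lambda>w. A w + B w) C = (\<lambda>w. conc_hat A C w + conc_hat B C w)"
  and conc_hat_add_right: "conc_hat C (\<lambda>w. A w + B w) = (\<lambda>w. conc_hat C A w + conc_hat C B w)"
  and conc_hat_scale_left: "conc_hat (\<lambda>w. c * A w) C = (\<lambda>w. c * conc_hat A C w)"
  and conc_hat_scale_right: "conc_hat C (\<lambda>w. c * A w) = (\<lambda>w. c * conc_hat C A w)"
  by (simp_all add: fun_eq_iff conc_hat_eq sum.distrib sum_distrib_left algebra_simps)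

section \<open>Homogeneous components and Lie series\<close>

definition homogeneous :: "nat \<Rightarrow> (forest \<Rightarrow>\<^sub>0 'k) \<Rightarrow> (forest \<Rightarrow>\<^sub>0 'k::field_char_0)" where
  "homogeneous n = lin_ext (\<lambda>w. if deg w = n then basis w else 0)"

lemma lookup_homogeneous: "lookup (homogeneous n x) w = (if deg w = n then lookup x w else 0)"
  by (induction x rule: basis_induct)
    (auto simp: homogeneous_def lookup_basis lookup_add simp del: basis_Nil)

lemma homogeneous_times: "homogeneous n (x * y) = (\<Sum>i\<le>n. homogeneous i x * homogeneous (n - i) y)"
proof (induction x rule: basis_induct)
  case (basis u)
  show ?case
  proof (induction y rule: basis_induct)
    case (basis v)
    have "(\<Sum>i\<le>n. homogeneous i (basis u) * homogeneous (n - i) (basis v) :: _ \<Rightarrow>\<^sub>0 'a) =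
        (\<Sum>i\<le>n. if i = deg u then if deg u + deg v = n then basis (u @ v) else 0 else 0)"
      by (rule sum.cong) (auto simp: homogeneous_def basis_append simp del: basis_Nil)
    also have "\<dots> = homogeneous n (basis u * basis v)"
      by (auto simp: homogeneous_def simp flip: basis_append)
    finally show ?case by simp
  qed (simp_all add: homogeneous_def distrib_left sum.distrib scale_sum)
qed (simp_all add: homogeneous_def distrib_right sum.distrib scale_sum)

lemma homogeneous_diff: "homogeneous n (x - y) = homogeneous n x - homogeneous n y"
  by (simp add: homogeneous_def)

lemma homogeneous_lie: "x \<in> lie_OT \<Longrightarrow> homogeneous n x \<in> lie_OT"
proof (induction arbitrary: n rule: lie_OT.induct)
  case (tree t)
  show ?case by (simp add: homogeneous_def lie_OT.intros)
next
  case (bracket x y)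
  \<comment> \<open>Reversing the index matches complementary degrees, so that commutators of
    components appear.\<close>
  have "homogeneous n (y * x) = (\<Sum>i\<le>n. homogeneous (n - i) y * homogeneous i x)"
    unfolding homogeneous_times
    by (rule sum.reindex_bij_witness[of _ "\<lambda>i. n - i" "\<lambda>i. n - i"]) auto
  then have "homogeneous n (x * y - y * x) =
      (\<Sum>i\<le>n. homogeneous i x * homogeneous (n - i) y - homogeneous (n - i) y * homogeneous i x)"
    by (simp only: homogeneous_diff sum_subtractf homogeneous_times[of n x y])
  then show ?case using bracket by (auto simp: conc_eq_times intro!: lie_sum lie_bracket)
qed (simp_all add: homogeneous_def lie_OT.intros)

text \<open>Truncations are easier to carry through products than single components, since a product
  mixes degrees. The way back uses that the components of a Lie element are Lie.\<close>

lemma lie_hat_iff: "p \<in> lie_hat \<longleftrightarrow> (\<forall>N. \<exists>x\<in>lie_OT. approx N p x)"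
proof
  assume "p \<in> lie_hat"
  then have "\<forall>n. \<exists>x. x \<in> lie_OT \<and> (\<forall>w. lookup x w = (if deg w = n then p w else 0))"
    unfolding lie_hat_def by blast
  then obtain x where x: "\<forall>n. x n \<in> lie_OT \<and> (\<forall>w. lookup (x n) w = (if deg w = n then p w else 0))"
    by (rule choice[THEN exE])
  then have "approx N p (\<Sum>n\<le>N. x n)" for N
    by (simp add: approx_def lookup_sum)
  moreover have "(\<Sum>n\<le>N. x n) \<in> lie_OT" for N using x by (intro lie_sum) simp
  ultimately show "\<forall>N. \<exists>x\<in>lie_OT. approx N p x" by blast
next
  assume *: "\<forall>N. \<exists>x\<in>lie_OT. approx N p x"
  have "\<exists>x\<in>lie_OT. \<forall>w. lookup x w = (if deg w = n then p w else 0)" for n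
  proof -
    from * obtain x where "x \<in> lie_OT" "approx n p x" by blast
    then show ?thesis
      by (intro bexI[of _ "homogeneous n x"]) (auto simp: lookup_homogeneous homogeneous_lie approx_def)
  qed
  then show "p \<in> lie_hat" by (simp add: lie_hat_def)
qed

lemma lookup_lie_hat: "x \<in> lie_OT \<Longrightarrow> lookup x \<in> lie_hat"
  unfolding lie_hat_iff using approx_lookup by blast

lemma lie_hat_Nil:
  assumes "p \<in> lie_hat"
  shows "p [] = 0"
proof -
  have "lookup x [] = 0" if "x \<in> lie_OT" for x :: "_ \<Rightarrow>\<^sub>0 'a"
    using that by induction (simp_all add: lookup_basis lookup_add lookup_minus conc_eq_times lookup_times)
  moreover obtain x where "x \<in> lie_OT" "approx 0 p x" using assms by (auto simp: lie_hat_iff)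
  ultimately show ?thesis by (simp add: approx_def)
qed

lemma lie_hat_linear:
  assumes "p \<in> lie_hat" "q \<in> lie_hat"
  shows "(\<lambda>w. c * p w + q w) \<in> lie_hat"
  unfolding lie_hat_iff
proof
  fix N
  from assms obtain x y where "x \<in> lie_OT" "approx N p x" "y \<in> lie_OT" "approx N q y"
    unfolding lie_hat_iff by blast
  then show "\<exists>z\<in>lie_OT. approx N (\<lambda>w. c * p w + q w) z"
    by (intro bexI[of _ "c *\<^sub>k x + y"] approx_linear(1)[OF approx_linear(3)] lie_OT.intros)
qed

lemma lie_hat_bracket:
  assumes "p \<in> lie_hat" "q \<in> lie_hat"
  shows "(\<lambda>w. conc_hat p q w - conc_hat q p w) \<in> lie_hat"
  unfolding lie_hat_iff
proof
  fix N
  from assms obtain x y where "x \<in> lie_OT" "approx N p x" "y \<in> lie_OT" "approx N q y"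
    unfolding lie_hat_iff by blast
  then show "\<exists>z\<in>lie_OT. approx N (\<lambda>w. conc_hat p q w - conc_hat q p w) z"
    by (intro bexI[of _ "x * y - y * x"] approx_linear(2) approx_conc lie_bracket)
qed

section \<open>The rules of the post-Lie product for series\<close>

lemma tri_hat_lie:
  assumes "p \<in> lie_hat"
  shows "tri_hat A p \<in> lie_hat"
  unfolding lie_hat_iff
proof
  fix N
  obtain x a where "x \<in> lie_OT" "approx N p x" "approx N A a"
    using assms ex_approx[of N A] unfolding lie_hat_iff by blast
  then show "\<exists>z\<in>lie_OT. approx N (tri_hat A p) z"
    by (intro bexI[of _ "a \<rhd> x"] approx_tri tri_lie)
qed

lemma tri_hat_conc:
  assumes "p \<in> lie_hat"
  shows "tri_hat p (conc_hat A B) = (\<lambda>w. conc_hat (tri_hat p A) B w + conc_hat A (tri_hat p B) w)"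
proof (rule hat_eqI)
  fix N
  obtain x a b where x: "x \<in> lie_OT" and "approx N p x" "approx N A a" "approx N B b"
    using assms ex_approx[of N A] ex_approx[of N B] unfolding lie_hat_iff by blast
  then show "\<exists>l. approx N (tri_hat p (conc_hat A B)) l \<and>
      approx N (\<lambda>w. conc_hat (tri_hat p A) B w + conc_hat A (tri_hat p B) w) l"
    by (intro exI[of _ "x \<rhd> (a * b)"] conjI, intro approx_tri approx_conc)
      (simp_all add: lie_tri_times approx_linear approx_tri approx_conc)
qed

lemma tri_hat_one:
  assumes "p \<in> lie_hat"
  shows "tri_hat p (lookup 1) = (\<lambda>w. 0)"
proof (rule hat_eqI)
  fix N
  obtain x where "x \<in> lie_OT" "approx N p x" using assms unfolding lie_hat_iff by blast
  then have "approx N (tri_hat p (lookup 1)) 0"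
    using approx_tri[of N p x "lookup 1" 1] by (simp add: lie_tri_one)
  then show "\<exists>l. approx N (tri_hat p (lookup 1)) l \<and> approx N (\<lambda>w. 0) l"
    by (intro exI[of _ 0]) (simp add: approx_def)
qed

lemma conc_tri_hat:
  assumes "p \<in> lie_hat"
  shows "tri_hat (conc_hat p A) B = (\<lambda>w. tri_hat p (tri_hat A B) w - tri_hat (tri_hat p A) B w)"
proof (rule hat_eqI)
  fix N
  obtain x a b where x: "x \<in> lie_OT" and "approx N p x" "approx N A a" "approx N B b"
    using assms ex_approx[of N A] ex_approx[of N B] unfolding lie_hat_iff by blast
  then show "\<exists>l. approx N (tri_hat (conc_hat p A) B) l \<and>
      approx N (\<lambda>w. tri_hat p (tri_hat A B) w - tri_hat (tri_hat p A) B w) l"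
    by (intro exI[of _ "(x * a) \<rhd> b"] conjI, intro approx_tri approx_conc)
      (simp_all add: lie_times_tri approx_linear approx_tri approx_conc)
qed

lemma one_tri_hat [simp]: "tri_hat (lookup 1) A = A"
  by (rule hat_eqI) (metis approx_lookup approx_tri ex_approx one_tri)

lemma tri_hat_add_left: "tri_hat (\<lambda>w. A w + B w) C = (\<lambda>w. tri_hat A C w + tri_hat B C w)"
  and tri_hat_add_right: "tri_hat C (\<lambda>w. A w + B w) = (\<lambda>w. tri_hat C A w + tri_hat C B w)"
  and tri_hat_scale_left: "tri_hat (\<lambda>w. c * A w) C = (\<lambda>w. c * tri_hat A C w)"
  and tri_hat_scale_right: "tri_hat C (\<lambda>w. c * A w) = (\<lambda>w. c * tri_hat C A w)"
  by (simp_all add: fun_eq_iff tri_hat_def case_prod_unfold distrib_left distrib_right mult.assoc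
      mult.left_commute pairing_fun_add pairing_fun_mult)


section \<open>Exponentials of Lie series are characters\<close>

lemma shuffle_words_Nil_right [simp]: "shuffle_words u [] = [u]"
  by (cases u) auto

lemma shuffle_words_deg:
  "w \<in> set (shuffle_words u v) \<Longrightarrow> length w = length u + length v \<and> deg w = deg u + deg v"
  by (induction u v arbitrary: w rule: shuffle_words.induct) auto

text \<open>The shuffle product is dual to the coproduct: both sides count the ways to split a word
  into complementary subwords \<open>u\<close> and \<open>v\<close>, and its first letter must be
  the first letter of \<open>u\<close> or of \<open>v\<close>.\<close>

lemma sum_shuffle_words: "(\<Sum>w\<leftarrow>shuffle_words u v. lookup a w) = lookup (coproduct a) (u, v)"
proof (induction a rule: basis_induct)
  case (basis w)
  have "(\<Sum>w'\<leftarrow>shuffle_words u v. if w = w' then 1 else 0) = (\<Sum>p\<leftarrow>unshuffle w. if p = (u, v) then 1 else 0 :: 'a)"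
  proof (induction w arbitrary: u v)
    case Nil
    have "(\<Sum>w'\<leftarrow>shuffle_words u v. if [] = w' then 1 else 0) =
        (\<Sum>w'\<leftarrow>shuffle_words u v. if u = [] \<and> v = [] then 1 else 0 :: 'a)"
      by (intro arg_cong[of _ _ sum_list] map_cong) (auto dest: shuffle_words_deg)
    then show ?case by auto
  next
    case (Cons t w)
    have *: "(\<Sum>p\<leftarrow>unshuffle (t # w). if p = (u, v) then 1 else 0 :: 'a) =
       (case u of [] \<Rightarrow> 0 | s # u' \<Rightarrow> if s = t then \<Sum>p\<leftarrow>unshuffle w. if p = (u', v) then 1 else 0 else 0) +
       (case v of [] \<Rightarrow> 0 | s # v' \<Rightarrow> if s = t then \<Sum>p\<leftarrow>unshuffle w. if p = (u, v') then 1 else 0 else 0)"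
      by (cases u; cases v) (auto simp: comp_def case_prod_unfold prod_eq_iff)
    show ?case
      unfolding * Cons[symmetric]
      by (cases u; cases v) (auto simp: comp_def)
  qed
  then show ?case by (simp add: lookup_basis sum_words_def lookup_sum_list del: basis_Nil)
qed (simp_all add: lookup_add sum_list_addf sum_list_const_mult)

lemma shuffle_simps [simp]:
  "0 \<squnion> y = 0" "x \<squnion> 0 = 0" "basis u \<squnion> basis v = sum_words (shuffle_words u v)"
  "(c *\<^sub>k x) \<squnion> y = c *\<^sub>k (x \<squnion> y)" "x \<squnion> (c *\<^sub>k y) = c *\<^sub>k (x \<squnion> y)"
  "(x + x') \<squnion> y = x \<squnion> y + x' \<squnion> y" "x \<squnion> (y + y') = x \<squnion> y + x \<squnion> y'"
  by (simp_all add: shuffle_def del: basis_Nil)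

lemma approx_power: "approx N p x \<Longrightarrow> approx N (power_hat p n) (x ^ n)"
  by (induction n) (simp_all add: approx_conc)

lemma power_hat_eq_0:
  assumes "p [] = 0" "length w < n"
  shows "power_hat p n w = 0"
  using assms(2)
proof (induction n arbitrary: w)
  case (Suc n)
  have "p (take i w) * power_hat p n (drop i w) = 0" if "i \<le> length w" for i
    by (cases i) (use that Suc assms(1) in auto)
  then show ?case by (simp add: conc_hat_eq del: mult_eq_0_iff)
qed simp

text \<open>One bound \<open>M\<close> can serve words of different lengths, as needed when the
  exponential is paired with sums of words.\<close>

lemma exp_hat_eq:
  assumes "p [] = 0" "length w \<le> M"
  shows "exp_hat p w = (\<Sum>n\<le>M. power_hat p n w / fact n)"
  unfolding exp_hat_def
  using assms(2) by (intro sum.mono_neutral_left) (auto simp: power_hat_eq_0[of p, OF assms(1)])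

text \<open>The component form of \<open>exp(x)\<close> being group-like, which needs no completed
  tensor square. Multiplying by \<open>x\<close> gives the factor \<open>k\<close> from the left
  tensor factor and \<open>Suc n - k\<close> from the right, with constant sum
  \<open>Suc n\<close>.\<close>

lemma coproduct_divided_power:
  fixes x :: "forest \<Rightarrow>\<^sub>0 'k::field_char_0"
  assumes "x \<in> lie_OT"
  defines "e \<equiv> \<lambda>n. (1 / fact n) *\<^sub>k x ^ n"
  shows "coproduct (e n) = (\<Sum>k\<le>n. e k \<otimes> e (n - k))"
proof (induction n)
  case 0
  show ?case by (simp add: e_def one_tensor_one)
next
  case (Suc n)
  have e: "x * e n = of_nat (Suc n) *\<^sub>k e (Suc n)" for n
    by (simp add: e_def del: of_nat_Suc)
  have "of_nat (Suc n) *\<^sub>k coproduct (e (Suc n)) = coproduct (x * e n)"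
    by (simp only: e coproduct_simps)
  also have "\<dots> = (\<Sum>k\<le>n. (x * e k) \<otimes> e (n - k)) + (\<Sum>k\<le>n. e k \<otimes> (x * e (n - k)))"
    by (simp add: coproduct_times lie_primitive[OF assms(1)] Suc distrib_right sum_distrib_left tensor_times sum.distrib)
  also have "(\<Sum>k\<le>n. (x * e k) \<otimes> e (n - k)) = (\<Sum>k\<le>n. of_nat (Suc k) *\<^sub>k (e (Suc k) \<otimes> e (Suc n - Suc k)))"
    by (simp only: e tensor_simps diff_Suc_Suc)
  \<comment> \<open>Both index ranges are extended to \<open>k \<le> Suc n\<close> by a summand with
    coefficient zero: \<open>k = 0\<close> here, \<open>k = Suc n\<close> for the other sum.\<close>
  also have "\<dots> = (\<Sum>k\<le>Suc n. of_nat k *\<^sub>k (e k \<otimes> e (Suc n - k)))"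
    unfolding sum.atMost_Suc_shift by simp
  also have "(\<Sum>k\<le>n. e k \<otimes> (x * e (n - k))) = (\<Sum>k\<le>n. of_nat (Suc n - k) *\<^sub>k (e k \<otimes> e (Suc n - k)))"
    by (rule sum.cong) (simp_all only: e tensor_simps Suc_diff_le atMost_iff)
  also have "\<dots> = (\<Sum>k\<le>Suc n. of_nat (Suc n - k) *\<^sub>k (e k \<otimes> e (Suc n - k)))"
    by simp
  also have "(\<Sum>k\<le>Suc n. of_nat k *\<^sub>k (e k \<otimes> e (Suc n - k))) +
      (\<Sum>k\<le>Suc n. of_nat (Suc n - k) *\<^sub>k (e k \<otimes> e (Suc n - k))) =
      (\<Sum>k\<le>Suc n. of_nat (Suc n) *\<^sub>k (e k \<otimes> e (Suc n - k)))"
    unfolding sum.distrib[symmetric] scale_add_left[symmetric] of_nat_add[symmetric]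
    by (rule sum.cong) simp_all
  also have "\<dots> = of_nat (Suc n) *\<^sub>k (\<Sum>k\<le>Suc n. e k \<otimes> e (Suc n - k))"
    by (simp only: scale_sum)
  finally have "(1 / of_nat (Suc n)) *\<^sub>k of_nat (Suc n) *\<^sub>k coproduct (e (Suc n)) =
      (1 / of_nat (Suc n)) *\<^sub>k of_nat (Suc n) *\<^sub>k (\<Sum>k\<le>Suc n. e k \<otimes> e (Suc n - k))"
    by (rule arg_cong)
  moreover have "(1 / of_nat (Suc n)) * of_nat (Suc n) = (1 :: 'k)"
    by (simp del: of_nat_Suc)
  ultimately show ?case by (simp only: scale_simps)
qed

text \<open>Only degrees up to \<open>deg u + deg v\<close> occur, so \<open>p\<close> may be
  replaced by a Lie element and the exponential by finitely many divided powers, whose coproduct is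
  known.\<close>

lemma exp_hat_shuffle:
  assumes p: "p \<in> lie_hat"
  shows "pairing (exp_hat p) (x \<squnion> y) = pairing (exp_hat p) x * pairing (exp_hat p) y"
proof -
  have words: "pairing (exp_hat p) (basis u \<squnion> basis v) = exp_hat p u * exp_hat p v" for u v
  proof -
    obtain x where x: "x \<in> lie_OT" and ap: "approx (deg u + deg v) p x"
      using p unfolding lie_hat_iff by blast
    define e where "e = (\<lambda>n. (1 / fact n) *\<^sub>k x ^ n)"
    have e: "power_hat p n w / fact n = lookup (e n) w" if "deg w \<le> deg u + deg v" for n w
      using approxD[OF approx_power[OF ap] that] by (simp add: e_def)
    have e0: "lookup (e n) w = 0" if "length w < n" "deg w \<le> deg u + deg v" for n w
      using e[OF that(2)] power_hat_eq_0[of p w n] that(1) lie_hat_Nil[OF p] by (metis div_0)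
    have E: "exp_hat p w = (\<Sum>n\<le>M. lookup (e n) w)" if "deg w \<le> deg u + deg v" "length w \<le> M" for w M
      unfolding exp_hat_eq[of p, OF lie_hat_Nil[OF p] that(2)] e[OF that(1)] ..
    have "pairing (exp_hat p) (basis u \<squnion> basis v) = (\<Sum>w\<leftarrow>shuffle_words u v. exp_hat p w)"
      by (simp add: sum_words_def pairing_sum_list del: basis_Nil)
    also have "\<dots> = (\<Sum>w\<leftarrow>shuffle_words u v. lookup (\<Sum>n\<le>length u + length v. e n) w)"
      by (intro arg_cong[of _ _ sum_list] map_cong)
        (auto simp: lookup_sum dest!: shuffle_words_deg intro!: E)
    also have "\<dots> = (\<Sum>n\<le>length u + length v. lookup (coproduct (e n)) (u, v))"
      unfolding sum_shuffle_words by (induction "length u + length v") (simp_all add: lookup_add coproduct_def lin_ext_sum lookup_sum)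
    also have "\<dots> = (\<Sum>n\<le>length u + length v. \<Sum>k\<le>n. lookup (e k) u * lookup (e (n - k)) v)"
      unfolding e_def coproduct_divided_power[OF x] lookup_sum lookup_tensor ..
    \<comment> \<open>A Cauchy product, read off from polynomial multiplication at 1. It has no
      remainder because \<open>e k\<close> vanishes on the words in question that are shorter than
      \<open>k\<close>.\<close>
    also have "\<dots> = (\<Sum>k\<le>length u. lookup (e k) u) * (\<Sum>k\<le>length v. lookup (e k) v)"
      using polynomial_product[of "length u" "\<lambda>k. lookup (e k) u" "length v" "\<lambda>k. lookup (e k) v" 1] e0 by simp
    also have "\<dots> = exp_hat p u * exp_hat p v" by (simp add: E[of u "length u"] E[of v "length v"])
    finally show ?thesis .
  qed
  show ?thesis
  proof (induction x rule: basis_induct)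
    case (basis u)
    show ?case
      by (induction y rule: basis_induct) (simp_all add: words distrib_left mult.left_commute del: shuffle_simps(3) basis_Nil)
  qed (simp_all add: distrib_right mult.assoc)
qed

text \<open>Substitution of \<open>p\<close> into a formal power series, so that log(exp(p)) = p is
  inherited from power series. The sum may stop at \<open>length w\<close> when \<open>p\<close> has
  no constant term.\<close>

definition fps_eval :: "(forest \<Rightarrow> 'k) \<Rightarrow> 'k fps \<Rightarrow> (forest \<Rightarrow> 'k::field_char_0)" where
  "fps_eval p f w = (\<Sum>m\<le>length w. fps_nth f m * power_hat p m w)"

lemma power_hat_add: "power_hat p (m + n) = conc_hat (power_hat p m) (power_hat p n)"
  by (induction m) (simp_all add: conc_hat_assoc)

lemma fps_eval_eq:
  assumes "p [] = 0" "length w \<le> M"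
  shows "fps_eval p f w = (\<Sum>m\<le>M. fps_nth f m * power_hat p m w)"
  unfolding fps_eval_def
  using assms(2) by (intro sum.mono_neutral_left) (auto simp: power_hat_eq_0[of p, OF assms(1)])

lemma fps_eval_mult:
  fixes p :: "forest \<Rightarrow> 'k::field_char_0"
  assumes "p [] = 0"
  shows "fps_eval p (f * g) = conc_hat (fps_eval p f) (fps_eval p g)"
proof
  fix w :: forest
  define L where "L = length w"
  define F where "F = (\<lambda>m l. fps_nth f m * fps_nth g l * power_hat p (m + l) w)"
  have "conc_hat (fps_eval p f) (fps_eval p g) w =
      (\<Sum>i\<le>L. (\<Sum>m\<le>L. fps_nth f m * power_hat p m (take i w)) * (\<Sum>l\<le>L. fps_nth g l * power_hat p l (drop i w)))"
    unfolding conc_hat_eq L_def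
    by (intro sum.cong refl arg_cong2[of _ _ _ _ "(*)"] fps_eval_eq[of p, OF assms]) simp_all
  also have "\<dots> = (\<Sum>m\<le>L. \<Sum>l\<le>L. \<Sum>i\<le>L.
      fps_nth f m * power_hat p m (take i w) * (fps_nth g l * power_hat p l (drop i w)))"
    unfolding sum_product by (rule trans[OF sum.swap], rule sum.cong[OF refl], rule sum.swap)
  also have "\<dots> = (\<Sum>m\<le>L. \<Sum>l\<le>L. F m l)"
    by (simp add: F_def power_hat_add conc_hat_eq L_def sum_distrib_left mult.assoc mult.left_commute)
  also have "\<dots> = (\<Sum>(m, l)\<in>{..L} \<times> {..L}. F m l)"
    by (simp add: sum.cartesian_product)
  \<comment> \<open>Outside the triangle the exponent \<open>m + l\<close> exceeds the length of
    \<open>w\<close>.\<close>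
  also have "\<dots> = (\<Sum>(m, l)\<in>{(m, l). m + l \<le> L}. F m l)"
  proof (rule sum.mono_neutral_right)
    have "F m l = 0" if "\<not> m + l \<le> L" for m l
      using that power_hat_eq_0[of p w "m + l"] assms by (simp add: F_def L_def)
    then show "\<forall>ml\<in>{..L} \<times> {..L} - {(m, l). m + l \<le> L}. (case ml of (m, l) \<Rightarrow> F m l) = 0" by auto
  qed auto
  also have "\<dots> = (\<Sum>r\<le>L. \<Sum>k\<le>r. F k (r - k))"
    by (rule sum.triangle_reindex_eq)
  also have "\<dots> = fps_eval p (f * g) w"
    by (simp add: fps_eval_def L_def F_def fps_mult_nth atMost_atLeast0 sum_distrib_right)
  finally show "fps_eval p (f * g) w = conc_hat (fps_eval p f) (fps_eval p g) w" ..
qed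

lemma fps_eval_power:
  assumes "p [] = 0"
  shows "fps_eval p (f ^ n) = power_hat (fps_eval p f) n"
proof (induction n)
  case 0
  show ?case
  proof
    fix w
    have "fps_eval p 1 w = (\<Sum>m\<le>length w. if m = 0 then lookup 1 w else 0)"
      unfolding fps_eval_def by (rule sum.cong) auto
    then show "fps_eval p (f ^ 0) w = power_hat (fps_eval p f) 0 w" by simp
  qed
qed (simp add: fps_eval_mult[of p, OF assms])

text \<open>A character turns convolution into multiplication of series, and \<open>J\<close>
  corresponds to \<open>exp(p) - 1\<close>.\<close>

lemma pairing_exp_J_power:
  fixes p :: "forest \<Rightarrow> 'k::field_char_0"
  assumes p: "p \<in> lie_hat"
  shows "pairing (exp_hat p) (J_power n x) = pairing (power_hat (fps_eval p (fps_exp 1 - 1)) n) x"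
proof (induction n arbitrary: x)
  case 0
  have "exp_hat p [] = 1" by (simp add: exp_hat_def lookup_1)
  moreover have "pairing (exp_hat p) 1 = exp_hat p []"
    unfolding one_eq_basis by (rule pairing_basis)
  moreover have "pairing (lookup 1) x = lookup x []"
    unfolding one_eq_basis by (rule pairing_lookup_basis)
  ultimately show ?case by simp
next
  case (Suc n)
  let ?q = "fps_eval p (fps_exp 1 - 1)"
  have "pairing (exp_hat p) (J (basis u)) = ?q u" for u
  proof -
    have "?q u = (\<Sum>m\<le>length u. power_hat p m u / fact m - (if m = 0 then lookup 1 u else 0))"
      unfolding fps_eval_def by (rule sum.cong) (auto simp: left_diff_distrib)
    also have "\<dots> = exp_hat p u - lookup 1 u" by (simp add: exp_hat_def sum_subtractf)
    finally have "?q u = exp_hat p u - lookup 1 u" .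
    moreover have "pairing (exp_hat p) 1 = exp_hat p []"
      unfolding one_eq_basis by (rule pairing_basis)
    ultimately show ?thesis
      by (simp add: J_def exp_hat_def lookup_basis lookup_1 del: basis_Nil)
  qed
  then have "pairing (exp_hat p) (J_power (Suc n) (basis w)) = power_hat ?q (Suc n) w" for w
    by (simp add: convolution_def pairing_lin_ext case_prod_unfold exp_hat_shuffle[OF p] Suc conc_hat_def
        del: basis_Nil)
  then show ?case
    by (induction x rule: basis_induct)
      (simp_all add: convolution_def deconc_def del: power_hat.simps)
qed

text \<open>The Euler idempotent is the convolution logarithm of the identity, so a character
  \<open>exp(p)\<close> sends it to log(exp(p)). The power series identity is compared only up to
  \<open>length w\<close>, where both truncations are exact.\<close>

lemma pairing_exp_euler:
  fixes p :: "forest \<Rightarrow> 'k::field_char_0"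
  assumes p: "p \<in> lie_hat"
  shows "pairing (exp_hat p) (euler_idem x) = pairing p x"
proof (induction x rule: basis_induct)
  case (basis w)
  let ?E = "fps_exp 1 - 1 :: 'k fps"
  let ?c = "\<lambda>n. (-1) ^ (n + 1) / of_nat n :: 'k"
  let ?L = "length w"
  have log_exp: "(\<Sum>n=1..?L. ?c n * fps_nth (?E ^ n) m) = (if m = 1 then 1 else 0)" if "m \<le> ?L" for m
  proof -
    \<comment> \<open>\<open>fps_ln 1\<close> is log(1 + X), the compositional inverse of exp(X) -
      1.\<close>
    have "fps_ln 1 oo ?E = fps_X"
      using fps_inv[of ?E] by (simp add: fps_ln_fps_exp_inv)
    then have "(if m = 1 then 1 else 0) = (\<Sum>i=0..m. fps_nth (fps_ln 1) i * fps_nth (?E ^ i) m)"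
      unfolding fps_compose_nth[symmetric] by simp
    also have "\<dots> = (\<Sum>i=1..?L. fps_nth (fps_ln 1) i * fps_nth (?E ^ i) m)"
    proof (rule sum.mono_neutral_cong)
      fix i assume "i \<in> {1..?L} - {0..m}"
      then show "fps_nth (fps_ln 1) i * fps_nth (?E ^ i) m = 0"
        using startsby_zero_power_prefix[of ?E i] by simp
    next
      \<comment> \<open>Since \<open>m \<le> ?L\<close>, only \<open>i = 0\<close> is left, and the
        logarithm has no constant term.\<close>
      fix i assume "i \<in> {0..m} - {1..?L}"
      with that show "fps_nth (fps_ln 1) i * fps_nth (?E ^ i) m = 0"
        by (auto simp: fps_ln_def)
    qed auto
    also have "\<dots> = (\<Sum>n=1..?L. ?c n * fps_nth (?E ^ n) m)"
    proof (rule sum.cong)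
      fix i assume "i \<in> {1..?L}"
      \<comment> \<open>This reconciles the sign exponents \<open>i - 1\<close> of the logarithm and
        \<open>i + 1\<close> of \<open>?c\<close>.\<close>
      then obtain j where "i = Suc j" by (cases i) auto
      then show "fps_nth (fps_ln 1) i * fps_nth (?E ^ i) m = ?c i * fps_nth (?E ^ i) m"
        by (simp add: fps_ln_def)
    qed simp
    finally show ?thesis ..
  qed
  have "pairing (exp_hat p) (euler_idem (basis w)) = (\<Sum>n=1..?L. ?c n * fps_eval p (?E ^ n) w)"
    unfolding fps_eval_power[of p, OF lie_hat_Nil[OF p]]
    by (simp add: euler_idem_def pairing_sum pairing_exp_J_power[OF p] del: basis_Nil)
  also have "\<dots> = (\<Sum>m\<le>?L. (\<Sum>n=1..?L. ?c n * fps_nth (?E ^ n) m) * power_hat p m w)"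
    unfolding fps_eval_def sum_distrib_left sum_distrib_right mult.assoc by (rule sum.swap)
  also have "\<dots> = (\<Sum>m\<le>?L. if m = 1 then power_hat p 1 w else 0)"
  proof (rule sum.cong)
    fix m assume "m \<in> {..?L}"
    then show "(\<Sum>n=1..?L. ?c n * fps_nth (?E ^ n) m) * power_hat p m w = (if m = 1 then power_hat p 1 w else 0)"
      by (subst log_exp) auto
  qed simp
  also have "\<dots> = (if 1 \<le> ?L then p w else 0)" by simp
  \<comment> \<open>The empty word is covered because a Lie series has no constant term.\<close>
  also have "\<dots> = p w" using lie_hat_Nil[OF p] by (cases w) auto
  finally show ?case by simp
qed (simp_all add: euler_idem_def)


section \<open>Substitution\<close>

text \<open>Grafting \<open>t\<close> onto \<open>Node C\<close> puts it at the root, as leftmost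
  branch, or inside \<open>C\<close>. The correction term of the recursion cancels exactly the
  second kind.\<close>

lemma act_bullet: "act B [bullet] = basis [Node B]"
proof (induction "length B" arbitrary: B)
  case (Suc n)
  then obtain t C where B: "B = t # C" "length C = n" by (cases B) auto
  have "act C' [bullet] = (basis [Node C'] :: _ \<Rightarrow>\<^sub>0 'a)" if "C' \<in> set (graft_forest t C)" for C'
    using Suc(1) B length_graft_forest[OF that] by simp
  then have "(\<Sum>C'\<leftarrow>graft_forest t C. act C' [bullet]) = (\<Sum>C'\<leftarrow>graft_forest t C. basis [Node C'] :: _ \<Rightarrow>\<^sub>0 'a)"
    by (intro arg_cong[of _ _ sum_list] map_cong) auto
  then show ?case
    using Suc(1)[of C] B by (simp add: B act_Cons_left[of t C] act_tree_graft sum_words_def comp_def)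
qed simp

lemma conc_hat_cong:
  assumes "\<And>v. deg v \<le> deg w \<Longrightarrow> A v = A' v" "\<And>v. deg v \<le> deg w \<Longrightarrow> B v = B' v"
  shows "conc_hat A B w = conc_hat A' B' w"
  unfolding conc_hat_eq using assms deg_take_le deg_drop_le by (intro sum.cong) auto

lemma tri_hat_cong:
  assumes "\<And>v. deg v \<le> deg w \<Longrightarrow> A v = A' v" "\<And>v. deg v \<le> deg w \<Longrightarrow> B v = B' v"
  shows "tri_hat A B w = tri_hat A' B' w"
  unfolding tri_hat_def using assms by (intro pairing_cong) (auto dest!: dual_tri_degree)

lemma conc_hat_lookup: "conc_hat (lookup x) (lookup y) = lookup (x * y)"
  by (rule hat_eqI) (use approx_conc approx_lookup in blast)

text \<open>The vanishing range grows by one degree, since \<open>p\<close> starts in degree one.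
  This accounts for the root in \<open>Node B\<close>.\<close>

lemma tri_hat_degree:
  assumes "\<And>w. deg w < m \<Longrightarrow> A w = 0" "p [] = 0" "deg w \<le> m"
  shows "tri_hat A p w = 0"
proof -
  have "tri_hat A p w = pairing (\<lambda>_. 0) (dual_tri (basis w) :: _ \<Rightarrow>\<^sub>0 'a)"
    unfolding tri_hat_def
  proof (rule pairing_cong)
    fix uv assume uv: "uv \<in> keys (dual_tri (basis w) :: _ \<Rightarrow>\<^sub>0 'a)"
    obtain u v where [simp]: "uv = (u, v)" by (cases uv)
    have "deg w = deg u + deg v" using uv by (intro dual_tri_degree) simp
    moreover have "deg v \<noteq> 0 \<or> v = []"
      by (cases v; cases "hd v") auto
    ultimately show "(case uv of (u, v) \<Rightarrow> A u * p v) = 0"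
      using assms by auto
  qed
  then show ?thesis by simp
qed

lemma conc_hat_degree:
  assumes "\<And>w. deg w < m \<Longrightarrow> A w = 0" "\<And>w. deg w < n \<Longrightarrow> B w = 0" "deg w < m + n"
  shows "conc_hat A B w = 0"
  unfolding conc_hat_eq
proof (rule sum.neutral, safe)
  fix i
  show "A (take i w) * B (drop i w) = 0"
    using assms deg_take_drop[of i w] by (cases "deg (take i w) < m") auto
qed

text \<open>The endomorphism \<open>a\<^sub>p\<close> on words: it maps \<open>B\<^sup>+(B) = B \<rhd> \<bullet>\<close> to \<open>a\<^sub>p(B) \<rhd> p\<close>.\<close>

fun subst_word :: "(forest \<Rightarrow> 'k) \<Rightarrow> forest \<Rightarrow> (forest \<Rightarrow> 'k::field_char_0)" where
  "subst_word p [] = lookup 1"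
| "subst_word p (Node B # C) = conc_hat (tri_hat (subst_word p B) p) (subst_word p C)"

text \<open>Both the branches of the first tree and the remaining forest get an induction
  hypothesis; the scheme is that of the recursion for \<open>subst_word\<close>.\<close>

lemma forest_induct [case_names Nil Node]:
  assumes "P []" "\<And>B C. P B \<Longrightarrow> P C \<Longrightarrow> P (Node B # C)"
  shows "P F"
  using subst_word.induct[of "\<lambda>_. P" undefined F] assms by blast

lemma subst_word_append: "subst_word p (A @ B) = conc_hat (subst_word p A) (subst_word p B)"
  by (induction p A rule: subst_word.induct) (simp_all add: conc_hat_assoc)

text \<open>Each vertex is replaced by a series that starts in degree one. Hence only finitely many
  words contribute to a given coefficient, both for the extension to series and for
  co-substitution.\<close>

lemma subst_word_degree:
  assumes "p [] = 0" "deg w < deg B"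
  shows "subst_word p B w = 0"
  using assms
proof (induction p B arbitrary: w rule: subst_word.induct)
  case (2 p B C)
  have "tri_hat (subst_word p B) p v = 0" if "deg v < Suc (deg B)" for v
    using tri_hat_degree[of "deg B" "subst_word p B" p v] 2 that by auto
  then show ?case
    using conc_hat_degree[of "Suc (deg B)" _ "deg C" "subst_word p C" w] 2 by auto
qed simp

definition subst_lin :: "(forest \<Rightarrow> 'k) \<Rightarrow> (forest \<Rightarrow>\<^sub>0 'k) \<Rightarrow> (forest \<Rightarrow> 'k::field_char_0)" where
  "subst_lin p a w = pairing (\<lambda>B. subst_word p B w) a"

lemma subst_lin_basis: "subst_lin p (basis B) = subst_word p B"
  by (simp add: subst_lin_def fun_eq_iff)

lemma subst_lin_one [simp]: "subst_lin p 1 = lookup 1"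
  using subst_lin_basis[of p "[]"] by simp

lemma subst_lin_linear:
  "subst_lin p (x + y) = (\<lambda>w. subst_lin p x w + subst_lin p y w)"
  "subst_lin p (x - y) = (\<lambda>w. subst_lin p x w - subst_lin p y w)"
  "subst_lin p (c *\<^sub>k x) = (\<lambda>w. c * subst_lin p x w)"
  "subst_lin p 0 = (\<lambda>w. 0)"
  by (simp_all add: subst_lin_def fun_eq_iff)

lemma hat_zero [simp]:
  "conc_hat (\<lambda>w. 0) A = (\<lambda>w. 0)" "conc_hat A (\<lambda>w. 0) = (\<lambda>w. 0)"
  "tri_hat (\<lambda>w. 0) A = (\<lambda>w. 0)" "tri_hat A (\<lambda>w. 0) = (\<lambda>w. 0)"
  by (simp_all add: fun_eq_iff conc_hat_eq tri_hat_def case_prod_unfold)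

lemma subst_lin_times: "subst_lin p (x * y) = conc_hat (subst_lin p x) (subst_lin p y)"
proof (induction x rule: basis_induct)
  case (basis A)
  show ?case
    by (induction y rule: basis_induct)
      (simp_all add: subst_lin_linear conc_hat_add_right conc_hat_scale_right distrib_left
        subst_lin_basis subst_word_append del: basis_Nil flip: basis_append)
qed (simp_all add: subst_lin_linear conc_hat_add_left conc_hat_scale_left distrib_right)

lemma subst_lin_tri_bullet: "subst_lin p (y \<rhd> basis [bullet]) = tri_hat (subst_lin p y) p"
  by (induction y rule: basis_induct)
    (simp_all add: subst_lin_linear tri_distribs tri_hat_add_left tri_hat_scale_left
      subst_lin_basis act_bullet del: basis_Nil)

lemma lookup_0: "lookup 0 = (\<lambda>w. 0)"
  by auto

lemma subst_lin_lie:
  assumes "p \<in> lie_hat" "x \<in> lie_OT"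
  shows "subst_lin p x \<in> lie_hat"
  using assms(2)
proof induction
  case (tree t)
  show ?case using assms(1) by (cases t) (simp add: subst_lin_basis tri_hat_lie)
next
  case zero
  show ?case using lookup_lie_hat[OF lie_OT.zero] by (simp add: subst_lin_linear lookup_0)
next
  case (add x y)
  then show ?case using lie_hat_linear[of _ _ 1] by (simp add: subst_lin_linear)
next
  case (scale x c)
  then show ?case
    using lie_hat_linear[of "subst_lin p x" "lookup 0" c] lookup_lie_hat[OF lie_OT.zero]
    by (simp add: subst_lin_linear)
next
  case (bracket x y)
  then show ?case by (simp add: conc_eq_times subst_lin_linear subst_lin_times lie_hat_bracket)
qed

text \<open>The derivation rule reduces the right argument to a tree \<open>Node B\<close>, and
  there x \<rhd> (B \<rhd> \<bullet>) = (xB + x \<rhd> B) \<rhd> \<bullet>. The same identity holds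
  for the images, because the image of \<open>x\<close> is a Lie series.\<close>

lemma subst_lin_tri:
  assumes p: "p \<in> lie_hat" and x: "x \<in> lie_OT"
  shows "subst_lin p (x \<rhd> y) = tri_hat (subst_lin p x) (subst_lin p y)"
proof -
  note px = subst_lin_lie[OF p x]
  have "subst_lin p (x \<rhd> basis F) = tri_hat (subst_lin p x) (subst_lin p (basis F))" for F
  proof (induction F rule: forest_induct)
    case Nil
    show ?case using tri_hat_one[OF px] by (simp add: lie_tri_one[OF x] subst_lin_linear)
  next
    case (Node B C)
    have "x \<rhd> basis [Node B] = ((x * basis B) \<rhd> basis [bullet]) + ((x \<rhd> basis B) \<rhd> basis [bullet])"
      by (simp only: lie_times_tri[OF x] tri_basis[of B] act_bullet) simp
    then have "subst_lin p (x \<rhd> basis [Node B]) = tri_hat (subst_lin p x) (tri_hat (subst_lin p (basis B)) p)"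
      by (simp add: subst_lin_linear subst_lin_tri_bullet subst_lin_times Node conc_tri_hat[OF px] del: basis_Nil)
    also have "\<dots> = tri_hat (subst_lin p x) (subst_lin p (basis [Node B]))"
      by (simp add: subst_lin_basis)
    finally show ?case
      using Node(2)
      by (simp add: basis_Cons[of "Node B" C] lie_tri_times[OF x] subst_lin_linear subst_lin_times tri_hat_conc[OF px]
          del: basis_Nil)
  qed
  then show ?thesis
    by (induction y rule: basis_induct)
      (simp_all add: subst_lin_linear tri_distribs tri_hat_add_right tri_hat_scale_right)
qed

section \<open>Extension to series and characterisation of the endomorphism\<close>

definition subst_hat :: "(forest \<Rightarrow> 'k) \<Rightarrow> (forest \<Rightarrow> 'k) \<Rightarrow> (forest \<Rightarrow> 'k::field_char_0)" where
  "subst_hat p A w = (\<Sum>B | deg B \<le> deg w. A B * subst_word p B w)"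

lemma subst_hat_approx:
  assumes "p [] = 0" "approx N A a" "deg w \<le> N"
  shows "subst_hat p A w = subst_lin p a w"
proof -
  have "subst_lin p a w = (\<Sum>B\<in>keys a \<union> {B. deg B \<le> deg w}. subst_word p B w * lookup a B)"
    unfolding subst_lin_def by (rule pairing_superset) (auto simp: finite_deg_le)
  also have "\<dots> = (\<Sum>B | deg B \<le> deg w. subst_word p B w * lookup a B)"
    by (rule sum.mono_neutral_right) (auto simp: finite_deg_le subst_word_degree[of p, OF assms(1)])
  also have "\<dots> = subst_hat p A w"
    unfolding subst_hat_def using assms by (intro sum.cong) (auto simp: approx_def)
  finally show ?thesis ..
qed

lemma subst_hat_lookup: "p [] = 0 \<Longrightarrow> subst_hat p (lookup a) = subst_lin p a"
  using subst_hat_approx[of p _ "lookup a" a] by auto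

lemma subst_hat_lie:
  assumes p: "p \<in> lie_hat" and "A \<in> lie_hat"
  shows "subst_hat p A \<in> lie_hat"
  unfolding lie_hat_iff
proof
  fix N
  obtain x where x: "x \<in> lie_OT" "approx N A x" using assms unfolding lie_hat_iff by blast
  obtain z where "z \<in> lie_OT" "approx N (subst_lin p x) z"
    using subst_lin_lie[OF p x(1)] unfolding lie_hat_iff by blast
  then show "\<exists>z\<in>lie_OT. approx N (subst_hat p A) z"
    using subst_hat_approx[of p, OF lie_hat_Nil[OF p] x(2)] by (auto simp: approx_def)
qed

abbreviation is_subst_endo :: "(forest \<Rightarrow> 'k) \<Rightarrow> ((forest \<Rightarrow> 'k) \<Rightarrow> (forest \<Rightarrow> 'k::field_char_0)) \<Rightarrow> bool" where
  "is_subst_endo p a \<equiv> algebra_endo_hat a \<and> continuous_hat a \<and> restricts_to_post_lie_endo a \<and>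
     a (lookup (basis [bullet])) = p"

lemma is_subst_endo_subst_hat:
  assumes p: "p \<in> lie_hat"
  shows "is_subst_endo p (subst_hat p)"
proof (intro conjI)
  have p0: "p [] = 0" by (rule lie_hat_Nil[OF p])
  note ap = subst_hat_approx[of p, OF p0]
  show "algebra_endo_hat (subst_hat p)"
    unfolding algebra_endo_hat_def
  proof (intro conjI allI)
    fix c and A B :: "forest \<Rightarrow> 'a"
    show "subst_hat p (\<lambda>w. c * A w + B w) = (\<lambda>w. c * subst_hat p A w + subst_hat p B w)"
      by (simp add: fun_eq_iff subst_hat_def distrib_right sum.distrib sum_distrib_left mult.assoc)
    show "subst_hat p (lookup (basis [])) = lookup (basis [])"
      by (simp add: subst_hat_lookup[of p, OF p0])
    show "subst_hat p (conc_hat A B) = conc_hat (subst_hat p A) (subst_hat p B)"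
    proof
      fix w
      obtain a b where ab: "approx (deg w) A a" "approx (deg w) B b" by (metis ex_approx)
      then have "subst_hat p (conc_hat A B) w = conc_hat (subst_lin p a) (subst_lin p b) w"
        by (simp add: ap[OF approx_conc[OF ab]] subst_lin_times)
      also have "\<dots> = conc_hat (subst_hat p A) (subst_hat p B) w"
        by (rule conc_hat_cong) (simp_all add: ap[OF ab(1)] ap[OF ab(2)])
      finally show "subst_hat p (conc_hat A B) w = conc_hat (subst_hat p A) (subst_hat p B) w" .
    qed
  qed
  show "continuous_hat (subst_hat p)"
    unfolding continuous_hat_def
  proof (intro allI)
    fix n
    show "\<exists>m. \<forall>A. (\<forall>w. deg w < m \<longrightarrow> A w = 0) \<longrightarrow> (\<forall>w. deg w < n \<longrightarrow> subst_hat p A w = 0)"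
      by (intro exI[of _ n]) (auto simp: subst_hat_def intro!: sum.neutral)
  qed
  show "restricts_to_post_lie_endo (subst_hat p)"
    unfolding restricts_to_post_lie_endo_def
  proof (intro conjI ballI)
    fix x y :: "forest \<Rightarrow> 'a" assume x: "x \<in> lie_hat"
    show "subst_hat p x \<in> lie_hat" by (rule subst_hat_lie[OF p x])
    show "subst_hat p (tri_hat x y) = tri_hat (subst_hat p x) (subst_hat p y)"
    proof
      fix w
      obtain a b where a: "a \<in> lie_OT" and ab: "approx (deg w) x a" "approx (deg w) y b"
        using x ex_approx[of "deg w" y] unfolding lie_hat_iff by blast
      then have "subst_hat p (tri_hat x y) w = tri_hat (subst_lin p a) (subst_lin p b) w"
        by (simp add: ap[OF approx_tri[OF ab]] subst_lin_tri[OF p a])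
      also have "\<dots> = tri_hat (subst_hat p x) (subst_hat p y) w"
        by (rule tri_hat_cong) (simp_all add: ap[OF ab(1)] ap[OF ab(2)])
      finally show "subst_hat p (tri_hat x y) w = tri_hat (subst_hat p x) (subst_hat p y) w" .
    qed
  qed
  show "subst_hat p (lookup (basis [bullet])) = p"
    by (simp add: subst_hat_lookup[of p, OF p0] subst_lin_basis)
qed

text \<open>Words reduce to trees by multiplicativity, but \<open>Node B = B \<rhd> bullet\<close>
  cannot be used directly because \<open>B\<close> need not be Lie. Instead the number of branches
  is lowered: \<open>Node (t # C)\<close> is \<open>t \<rhd> Node C\<close>, a product of two trees,
  minus trees \<open>Node C'\<close> with \<open>length C' = length C\<close>.\<close>

lemma is_subst_endo_unique:
  fixes p :: "forest \<Rightarrow> 'k::field_char_0"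
  assumes a: "is_subst_endo p a" and p: "p \<in> lie_hat"
  shows "a = subst_hat p"
proof -
  have lin: "a (\<lambda>w. c * A w + B w) = (\<lambda>w. c * a A w + a B w)" for c A B
    using a unfolding algebra_endo_hat_def by blast
  define L where "L = (\<lambda>x. a (lookup x))"
  have bullet: "L (basis [bullet]) = p" using a by (simp add: L_def)
  have one: "L 1 = lookup 1" using a unfolding algebra_endo_hat_def L_def by simp
  have zero: "a (\<lambda>w. 0) = (\<lambda>w. 0)" using lin[of "-1" "\<lambda>w. 0" "\<lambda>w. 0"] by simp
  have add: "L (x + y) = (\<lambda>w. L x w + L y w)" for x y
    using lin[of 1 "lookup x" "lookup y"] by (simp add: L_def lookup_add[abs_def] plus_poly_mapping.rep_eq)
  have scale: "L (c *\<^sub>k x) = (\<lambda>w. c * L x w)" for c x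
  proof -
    have "lookup (c *\<^sub>k x) = (\<lambda>w. c * lookup x w + 0)" by auto
    then show ?thesis unfolding L_def using lin[of c "lookup x" "\<lambda>w. 0"] by (simp add: zero)
  qed
  have L0: "L 0 = (\<lambda>w. 0)" using scale[of 0 0] by simp
  have minus: "L (x - y) = (\<lambda>w. L x w - L y w)" for x y
    using add[of x "(-1) *\<^sub>k y"] by (simp add: scale[of "-1" y, simplified])
  have times: "L (x * y) = conc_hat (L x) (L y)" for x y
    using a unfolding algebra_endo_hat_def L_def conc_hat_lookup[symmetric] by blast
  have lie: "L x \<in> lie_hat" if "x \<in> lie_OT" for x
    using a lookup_lie_hat[OF that] unfolding restricts_to_post_lie_endo_def L_def by blast
  have tri: "L (x \<rhd> y) = tri_hat (L x) (L y)" if "x \<in> lie_OT" "y \<in> lie_OT" for x y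
    using a lookup_lie_hat[OF that(1)] lookup_lie_hat[OF that(2)]
    unfolding restricts_to_post_lie_endo_def L_def tri_hat_lookup[symmetric] by blast
  have sum_list: "L (sum_words ws) = (\<lambda>w. \<Sum>B\<leftarrow>ws. L (basis B) w)" for ws
    by (induction ws) (simp_all add: sum_words_def add L0)
  \<comment> \<open>A word on the right need not be Lie; the derivation rule splits it into letters,
    which are.\<close>
  have tri_tree: "L (basis [t] \<rhd> basis B) = tri_hat (L (basis [t])) (L (basis B))" for t B
  proof (induction B)
    case Nil
    show ?case
      using tri_hat_one[OF lie[OF lie_OT.tree]] by (simp add: one L0 lie_tri_one[OF lie_OT.tree] del: tri_basis)
  next
    case (Cons s B)
    then show ?case
      by (simp add: basis_Cons[of s B] tree_tri_times add times tri[OF lie_OT.tree lie_OT.tree]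
          tri_hat_conc[OF lie[OF lie_OT.tree]] del: tri_basis)
  qed
  have Node: "L (basis [Node B]) = tri_hat (L (basis B)) p" for B
  proof (induction "length B" arbitrary: B)
    case 0
    then show ?case by (simp add: bullet one)
  next
    case (Suc n)
    then obtain t C where B: "B = t # C" "length C = n" by (cases B) auto
    have IH: "L (basis [Node C']) = tri_hat (L (basis C')) p" if "length C' = n" for C'
      using Suc(1) that by simp
    have sw: "L (sum_words ws \<rhd> basis [bullet]) = tri_hat (L (sum_words ws)) p"
      if "\<And>w. w \<in> set ws \<Longrightarrow> length w = n" for ws
      using that
      by (induction ws)
        (simp_all add: sum_words_def L0 tri_distribs add tri_hat_add_left act_bullet IH del: basis_Nil)
    have "basis [Node B] = (basis [t] \<rhd> basis [Node C] :: _ \<Rightarrow>\<^sub>0 'k) - ((basis [t] \<rhd> basis C) \<rhd> basis [bullet])"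
      using tree_times_tri[of t "basis C" "basis [bullet]"]
      by (simp add: B act_bullet flip: basis_Cons)
    then have "L (basis [Node B]) =
        (\<lambda>w. L (basis [t] \<rhd> basis [Node C]) w - L ((basis [t] \<rhd> basis C) \<rhd> basis [bullet]) w)"
      by (simp only: minus)
    also have "L ((basis [t] \<rhd> basis C) \<rhd> basis [bullet]) = tri_hat (L (basis [t] \<rhd> basis C)) p"
      unfolding tri_basis[of "[t]" C] act_tree_graft
      by (rule sw) (simp add: B length_graft_forest)
    also have "L (basis [t] \<rhd> basis [Node C]) = tri_hat (L (basis [t])) (tri_hat (L (basis C)) p)"
      by (simp only: tri[OF lie_OT.tree lie_OT.tree] IH[OF B(2)])
    finally show ?case
      by (simp only: tri_tree B basis_Cons[of t C] times conc_tri_hat[OF lie[OF lie_OT.tree]])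
  qed
  have word: "L (basis B) = subst_word p B" for B
  proof (induction B rule: forest_induct)
    case Nil
    show ?case by (simp add: one)
  next
    case (Node B C)
    then show ?case by (simp add: basis_Cons[of "Node B" C] times \<open>\<And>B. L (basis [Node B]) = _\<close>)
  qed
  have Lx: "L x = subst_lin p x" for x
    by (induction x rule: basis_induct) (simp_all add: word subst_lin_basis subst_lin_linear add scale L0 del: basis_Nil)
  show ?thesis
  proof (intro ext)
    fix A :: "forest \<Rightarrow> 'k" and w
    \<comment> \<open>Continuity makes the tail of \<open>A\<close> from degree \<open>m\<close> on
      irrelevant at \<open>w\<close>, and linearity leaves a finite truncation. It is taken up to at
      least \<open>deg w\<close>, so that \<open>subst_hat\<close> is also computed from it.\<close>
    obtain m where m: "\<And>A v. (\<forall>w. deg w < m \<longrightarrow> A w = 0) \<Longrightarrow> deg v < Suc (deg w) \<Longrightarrow> a A v = 0"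
      using a unfolding continuous_hat_def by meson
    obtain x where x: "approx (max m (deg w)) A x" using ex_approx by blast
    have "a (\<lambda>w. (-1) * lookup x w + A w) w = 0"
      by (rule m) (use x in \<open>auto simp: approx_def\<close>)
    then have "a A w = L x w" unfolding lin by (simp add: L_def)
    then show "a A w = subst_hat p A w"
      by (simp add: Lx subst_hat_approx[of p, OF lie_hat_Nil[OF p] x])
  qed
qed

lemma subst_endo_lookup:
  assumes "p \<in> lie_hat"
  shows "subst_endo p (lookup a) = subst_lin p a"
proof -
  have "subst_endo p = subst_hat p"
    unfolding subst_endo_def
    by (rule the_equality) (rule is_subst_endo_subst_hat[OF assms], rule is_subst_endo_unique[OF _ assms])
  then show ?thesis by (simp add: subst_hat_lookup[of p, OF lie_hat_Nil[OF assms]])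
qed


section \<open>Co-substitution\<close>

lemma pairing_commute: "pairing (lookup x) y = pairing (lookup y) x"
  by (induction y rule: basis_induct) (simp_all add: lookup_add pairing_fun_add pairing_fun_mult del: basis_Nil)

lemma scale_power: "(c *\<^sub>k x) ^ n = c ^ n *\<^sub>k x ^ n"
  for x :: "'a::monoid_add \<Rightarrow>\<^sub>0 'k::field_char_0"
  by (induction n) (simp_all add: mult.commute[of c])

lemma power_hat_lookup: "power_hat (lookup x) n = lookup (x ^ n)"
  by (induction n) (simp_all add: conc_hat_lookup)

text \<open>Replacing a Lie element \<open>x\<close> by \<open>c *\<^sub>k x\<close> makes the
  pairing a polynomial in \<open>c\<close> that vanishes everywhere. Its coefficients are the
  pairings with the powers of \<open>x\<close>, and these powers span.\<close>

lemma exp_hat_separates: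
  fixes \<xi> :: "forest \<Rightarrow>\<^sub>0 'k::field_char_0"
  assumes "\<And>p. p \<in> lie_hat \<Longrightarrow> pairing (exp_hat p) \<xi> = 0"
  shows "\<xi> = 0"
proof -
  have "pairing (lookup (x ^ n)) \<xi> = 0" if x: "x \<in> lie_OT" for x n
  proof -
    \<comment> \<open>\<open>M\<close> bounds the lengths of all words in \<open>\<xi>\<close>, so
      the exponential may stop there, and also \<open>n\<close>, whose coefficient is to be read
      off.\<close>
    define M where "M = Max (insert n (length ` keys \<xi>))"
    have M: "length w \<le> M" if "w \<in> keys \<xi>" for w
      unfolding M_def using that by (intro Max_ge) auto
    have "n \<le> M" unfolding M_def by (intro Max_ge) auto
    define Q where "Q = (\<Sum>m\<le>M. monom (pairing (lookup (x ^ m)) \<xi> / fact m) m)"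
    have "poly Q c = 0" for c
    proof -
      have p: "lookup (c *\<^sub>k x) \<in> lie_hat" by (intro lookup_lie_hat lie_OT.scale x)
      have "0 = pairing (exp_hat (lookup (c *\<^sub>k x))) \<xi>" using assms[OF p] by simp
      also have "\<dots> = pairing (\<lambda>w. \<Sum>m\<le>M. c ^ m / fact m * lookup (x ^ m) w) \<xi>"
        by (rule pairing_cong)
          (simp add: exp_hat_eq[of "lookup (c *\<^sub>k x)", OF lie_hat_Nil[OF p] M] power_hat_lookup scale_power)
      also have "\<dots> = (\<Sum>m\<le>M. c ^ m / fact m * pairing (lookup (x ^ m)) \<xi>)"
        by (simp only: pairing_fun_sum pairing_fun_mult)
      finally show ?thesis by (simp add: Q_def poly_sum poly_monom mult.commute)
    qed
    then have "Q = 0" by (simp flip: poly_all_0_iff_0)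
    then have "coeff Q n = 0" by simp
    then show ?thesis using \<open>n \<le> M\<close> by (simp add: Q_def coeff_sum)
  qed
  then have "pairing (lookup \<xi>) (x ^ n) = 0" if "x \<in> lie_OT" for x n
    using that pairing_commute by metis
  then have "lookup \<xi> w = 0" for w by (rule pairing_lie_powers_eq_0)
  then show ?thesis by (intro poly_mapping_eqI) simp
qed

section \<open>Test functionals on the tensor product\<close>

definition exp_coeff :: "(forest \<Rightarrow> 'k) \<Rightarrow> forest \<Rightarrow> (forest \<times> forest \<Rightarrow>\<^sub>0 'k) \<Rightarrow> 'k::field_char_0" where
  "exp_coeff p A y = pairing (\<lambda>(u, v). exp_hat p u * lookup (basis A) v) y"

lemma exp_coeff_tensor: "exp_coeff p A (x \<otimes> y) = pairing (exp_hat p) x * lookup y A"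
  by (simp add: exp_coeff_def pairing_tensor del: basis_Nil)

lemma exp_coeff_basis: "exp_coeff p A (basis (u, v)) = exp_hat p u * lookup (basis v) A"
  by (simp add: exp_coeff_def lookup_basis eq_commute[of A] del: basis_Nil)

lemma exp_coeff_linear:
  "exp_coeff p A 0 = 0" "exp_coeff p A (x + y) = exp_coeff p A x + exp_coeff p A y"
  "exp_coeff p A (x - y) = exp_coeff p A x - exp_coeff p A y" "exp_coeff p A (c *\<^sub>k x) = c * exp_coeff p A x"
  "exp_coeff p A (sum f S) = (\<Sum>i\<in>S. exp_coeff p A (f i))"
  "exp_coeff p A (lin_ext g z) = pairing (\<lambda>a. exp_coeff p A (g a)) z"
  by (simp_all add: exp_coeff_def pairing_sum pairing_lin_ext del: basis_Nil)

text \<open>Fixing \<open>A\<close> turns \<open>y\<close> into its slice \<open>\<xi>\<close> over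
  \<open>A\<close>, to which the separation by exponentials applies.\<close>

lemma exp_coeff_separates:
  fixes y :: "forest \<times> forest \<Rightarrow>\<^sub>0 'k::field_char_0"
  assumes "\<And>p A. p \<in> lie_hat \<Longrightarrow> exp_coeff p A y = 0"
  shows "y = 0"
proof (rule poly_mapping_eqI)
  fix uv :: "forest \<times> forest"
  obtain u A where uv: "uv = (u, A)" by (cases uv)
  define \<xi> where "\<xi> = lin_ext (\<lambda>(u, v). if v = A then basis u else 0) y"
  have "pairing (exp_hat p) \<xi> = exp_coeff p A y" for p
    unfolding \<xi>_def exp_coeff_def pairing_lin_ext
    by (rule pairing_cong) (auto simp: lookup_basis simp del: basis_Nil)
  then have "\<xi> = 0" using assms exp_hat_separates by metis
  moreover have "lookup \<xi> u = lookup y (u, A)"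
    unfolding \<xi>_def
    by (induction y rule: basis_induct) (auto simp: lookup_basis lookup_add case_prod_unfold simp del: basis_Nil)
  ultimately show "lookup y uv = lookup 0 uv" by (simp add: uv)
qed

lemma exp_coeff_eqI:
  assumes "\<And>p A. p \<in> lie_hat \<Longrightarrow> exp_coeff p A x = exp_coeff p A y"
  shows "x = y"
  using exp_coeff_separates[of "x - y"] assms by (simp add: exp_coeff_linear)

text \<open>The coordinate ring of \<open>lie_hat\<close>, as functions.\<close>

definition regular :: "((forest \<Rightarrow> 'k) \<Rightarrow> 'k::field_char_0) \<Rightarrow> bool" where
  "regular f \<longleftrightarrow> (\<exists>\<xi>. \<forall>p\<in>lie_hat. f p = pairing (exp_hat p) \<xi>)"

lemma pairing_exp_one [simp]: "pairing (exp_hat p) 1 = 1"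
proof -
  have "pairing (exp_hat p) 1 = exp_hat p []" unfolding one_eq_basis by (rule pairing_basis)
  then show ?thesis by (simp add: exp_hat_def lookup_1)
qed

lemma regular_const: "regular (\<lambda>p. c)"
  unfolding regular_def by (intro exI[of _ "c *\<^sub>k 1"]) simp

lemma regular_coordinate: "regular (\<lambda>p. p w)"
  unfolding regular_def by (intro exI[of _ "euler_idem (basis w)"]) (simp add: pairing_exp_euler del: basis_Nil)

lemma regular_mult: "regular f \<Longrightarrow> regular g \<Longrightarrow> regular (\<lambda>p. f p * g p)"
  unfolding regular_def by (metis exp_hat_shuffle)

lemma regular_sum:
  assumes "\<And>i. i \<in> I \<Longrightarrow> regular (f i)"
  shows "regular (\<lambda>p. \<Sum>i\<in>I. f i p)"
proof -
  from assms obtain \<xi> where "\<And>i p. i \<in> I \<Longrightarrow> p \<in> lie_hat \<Longrightarrow> f i p = pairing (exp_hat p) (\<xi> i)"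
    unfolding regular_def by metis
  then show ?thesis
    unfolding regular_def by (intro exI[of _ "\<Sum>i\<in>I. \<xi> i"]) (simp add: pairing_sum)
qed

text \<open>Along \<open>subst_word\<close> a coefficient is built by finite sums and products from
  constants and coordinates of \<open>p\<close>, because both dual coproducts are finite on a word.
  Regularity is what lets co-substitution exist.\<close>

lemma regular_subst_word: "regular (\<lambda>p :: forest \<Rightarrow> 'k::field_char_0. subst_word p A w)"
proof (induction A arbitrary: w rule: forest_induct)
  case Nil
  show ?case by (simp add: regular_const)
next
  case (Node B C)
  have "regular (\<lambda>p :: forest \<Rightarrow> 'k. tri_hat (subst_word p B) p v)" for v
    unfolding tri_hat_def pairing_def case_prod_unfold
    by (intro regular_sum regular_mult regular_const regular_coordinate Node)
  then show ?case
    unfolding subst_word.simps conc_hat_eq by (intro regular_sum regular_mult Node)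
qed

lemma vector_space_linear_lin_ext: "Vector_Spaces.linear (*\<^sub>k) (*\<^sub>k) (lin_ext f)"
  by (intro Vector_Spaces.linear.intro module_hom.intro module_hom_axioms.intro vector_space_scale
      vector_space_scale[unfolded vector_space_def, folded module_def])
    simp_all

abbreviation is_cosubst :: "((forest \<Rightarrow>\<^sub>0 'k) \<Rightarrow> (forest \<times> forest \<Rightarrow>\<^sub>0 'k::field_char_0)) \<Rightarrow> bool" where
  "is_cosubst D \<equiv> Vector_Spaces.linear (*\<^sub>k) (*\<^sub>k) D \<and>
     (\<forall>p\<in>lie_hat. \<forall>A x. pairing (subst_endo p (lookup A)) x =
        pairing (\<lambda>(u, v). exp_hat p u * lookup A v) (D x))"

text \<open>The slice of \<open>D (basis w)\<close> over \<open>A\<close> is an element representing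
  the regular function that takes \<open>p\<close> to the coefficient of \<open>w\<close> in a_p(A).
  Terms with \<open>deg A > deg w\<close> are absent because that coefficient is zero.\<close>

lemma ex_cosubst: "\<exists>D :: (forest \<Rightarrow>\<^sub>0 'k::field_char_0) \<Rightarrow> _. is_cosubst D"
proof -
  obtain \<xi> where \<xi>: "\<And>A w p. p \<in> lie_hat \<Longrightarrow> subst_word p A w = pairing (exp_hat p) (\<xi> A w :: _ \<Rightarrow>\<^sub>0 'k)"
    using regular_subst_word unfolding regular_def by metis
  define D where "D = lin_ext (\<lambda>w. \<Sum>A | deg A \<le> deg w. \<xi> A w \<otimes> basis A)"
  have D_linear: "D (x + y) = D x + D y" "D (c *\<^sub>k x) = c *\<^sub>k D x" "D 0 = 0" for c x y
    by (simp_all add: D_def)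
  have D: "exp_coeff p A (D (basis w)) = subst_word p A w" if p: "p \<in> lie_hat" for p A w
  proof -
    have "exp_coeff p A (D (basis w)) =
        (\<Sum>B | deg B \<le> deg w. if B = A then pairing (exp_hat p) (\<xi> A w) else 0)"
      by (auto simp: D_def exp_coeff_linear exp_coeff_tensor lookup_basis simp del: basis_Nil intro!: sum.cong)
    then show ?thesis
      using \<xi>[OF p, of A w] subst_word_degree[of p w A] lie_hat_Nil[OF p]
      by (auto simp: finite_deg_le)
  qed
  have "pairing (subst_endo p (lookup A)) x = pairing (\<lambda>(u, v). exp_hat p u * lookup A v) (D x)"
    if p: "p \<in> lie_hat" for p A x
    unfolding subst_endo_lookup[OF p]
  proof (induction A rule: basis_induct)
    case (basis A)
    show ?case
      by (induction x rule: basis_induct)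
        (simp_all add: D_linear D[OF p, unfolded exp_coeff_def] subst_lin_basis del: basis_Nil)
  qed (simp_all add: subst_lin_linear lookup_add case_prod_unfold pairing_fun_add pairing_fun_mult
      distrib_left mult.left_commute)
  then show ?thesis unfolding D_def using vector_space_linear_lin_ext by blast
qed

text \<open>Separation makes the map with the defining property unique, which resolves the definite
  description.\<close>

lemma exp_coeff_cosubst:
  fixes p :: "forest \<Rightarrow> 'k::field_char_0"
  assumes p: "p \<in> lie_hat"
  shows "exp_coeff p A (cosubst (basis w)) = subst_word p A w"
proof -
  obtain D :: "(forest \<Rightarrow>\<^sub>0 'k) \<Rightarrow> _" where D: "is_cosubst D" using ex_cosubst by blast
  have "D' = D" if D': "is_cosubst D'" for D'
  proof
    fix x
    show "D' x = D x"
    proof (rule exp_coeff_eqI)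
      fix q :: "forest \<Rightarrow> 'k" and B assume "q \<in> lie_hat"
      with D D' show "exp_coeff q B (D' x) = exp_coeff q B (D x)"
        unfolding exp_coeff_def by metis
    qed
  qed
  then have "cosubst = D" unfolding cosubst_def using D by (intro the_equality)
  then have "exp_coeff p A (cosubst (basis w)) = pairing (subst_endo p (lookup (basis A))) (basis w)"
    using D p unfolding exp_coeff_def by metis
  then show ?thesis by (simp add: subst_endo_lookup[OF p] subst_lin_basis del: basis_Nil)
qed

section \<open>The recursion under the test functionals\<close>

lemma exp_coeff_proj_trees:
  "exp_coeff p A (map_second proj_trees x) = (if length A = 1 then exp_coeff p A x else 0)"
  by (induction x rule: basis_induct)
    (auto simp: map_second_def exp_coeff_linear exp_coeff_tensor exp_coeff_basis proj_trees_def
      lookup_basis simp del: basis_Nil)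

lemma exp_coeff_Bplus:
  "exp_coeff p [Node B] (map_second Bplus x) = exp_coeff p B x"
  "length A \<noteq> 1 \<Longrightarrow> exp_coeff p A (map_second Bplus x) = 0"
  by (induction x rule: basis_induct)
    (auto simp: map_second_def exp_coeff_linear exp_coeff_tensor exp_coeff_basis Bplus_def
      lookup_basis simp del: basis_Nil)

text \<open>In the first factor \<open>exp(p)\<close> multiplies over shuffles; in the second,
  concatenation turns into deconcatenation of the test word \<open>A\<close>.\<close>

lemma exp_coeff_shuffle13_conc24:
  assumes p: "p \<in> lie_hat"
  shows "exp_coeff p A (shuffle13_conc24 (X \<otimes> Y)) =
    (\<Sum>i\<le>length A. exp_coeff p (take i A) X * exp_coeff p (drop i A) Y)"
proof (induction X rule: basis_induct)
  case (basis w)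
  show ?case
  proof (induction Y rule: basis_induct)
    case (basis v)
    show ?case
      by (cases w; cases v)
        (simp add: shuffle13_conc24_def exp_coeff_tensor exp_coeff_basis exp_hat_shuffle[OF p] conc_eq_times
          lookup_times sum_distrib_left mult.assoc mult.left_commute del: basis_Nil shuffle_simps(3))
  qed (simp_all add: shuffle13_conc24_def tensor_distribs exp_coeff_linear distrib_left sum.distrib
      sum_distrib_left mult.left_commute)
qed (simp_all add: shuffle13_conc24_def tensor_distribs exp_coeff_linear distrib_right sum.distrib
    sum_distrib_left mult.assoc)

lemma exp_coeff_shuffle135_conc24:
  assumes p: "p \<in> lie_hat"
  shows "exp_coeff p A (shuffle135_conc24 (X \<otimes> Y \<otimes> z)) =
    (\<Sum>i\<le>length A. exp_coeff p (take i A) X * exp_coeff p (drop i A) Y) * pairing (exp_hat p) z"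
proof (induction X rule: basis_induct)
  case (basis w)
  show ?case
  proof (induction Y rule: basis_induct)
    case (basis v)
    show ?case
    proof (induction z rule: basis_induct)
      case (basis u)
      show ?case
        by (cases w; cases v)
          (simp add: shuffle135_conc24_def exp_coeff_tensor exp_coeff_basis exp_hat_shuffle[OF p] conc_eq_times
            lookup_times sum_distrib_left sum_distrib_right mult.assoc mult.left_commute mult.commute
            del: basis_Nil shuffle_simps(3))
    qed (simp_all add: shuffle135_conc24_def tensor_distribs exp_coeff_linear distrib_left mult.left_commute)
  qed (simp_all add: shuffle135_conc24_def tensor_distribs exp_coeff_linear distrib_left distrib_right sum.distrib
      sum_distrib_left[symmetric] mult.left_commute mult.assoc)
qed (simp_all add: shuffle135_conc24_def tensor_distribs exp_coeff_linear distrib_right sum.distrib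
    sum_distrib_left[symmetric] mult.assoc)

lemma exp_coeff_U_star:
  assumes "p \<in> lie_hat"
  shows "exp_coeff p A (U_star (basis w)) = (if length A = 1 then subst_word p A w else 0)"
  by (simp add: U_star_def exp_coeff_proj_trees exp_coeff_cosubst[OF assms] del: basis_Nil)

lemma sweedler_deconc:
  "sweedler F (deconc (basis w)) = (\<Sum>j\<le>length w. F (basis (take j w)) (basis (drop j w)))"
  by (simp add: sweedler_def deconc_basis lin_ext_sum del: basis_Nil)

theorem proposition6p4:
  fixes w :: forest and \<omega> :: "forest \<Rightarrow>\<^sub>0 'k::field_char_0"
  assumes "w \<noteq> []" and "\<omega> = basis w"
  shows "cosubst \<omega> =
           sweedler (\<lambda>\<omega>1 \<omega>2. shuffle13_conc24 (cosubst \<omega>1 \<otimes> U_star \<omega>2)) (deconc \<omega>)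
       \<and> sweedler (\<lambda>\<omega>1 \<omega>2. shuffle13_conc24 (cosubst \<omega>1 \<otimes> U_star \<omega>2)) (deconc \<omega>) =
           sweedler (\<lambda>\<omega>1 \<omega>2.
             sweedler (\<lambda>\<omega>21 \<omega>22.
               shuffle135_conc24 (cosubst \<omega>1 \<otimes> map_second Bplus (cosubst \<omega>21) \<otimes> euler_idem \<omega>22))
             (dual_tri \<omega>2))
           (deconc \<omega>)"
proof
  show "cosubst \<omega> = sweedler (\<lambda>\<omega>1 \<omega>2. shuffle13_conc24 (cosubst \<omega>1 \<otimes> U_star \<omega>2)) (deconc \<omega>)"
    unfolding \<open>\<omega> = basis w\<close> sweedler_deconc
  proof (rule exp_coeff_eqI)
    fix p :: "forest \<Rightarrow> 'k" and A assume p: "p \<in> lie_hat"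
    let ?R = "\<Sum>j\<le>length w. shuffle13_conc24 (cosubst (basis (take j w)) \<otimes> U_star (basis (drop j w)))"
    have R: "exp_coeff p A ?R = (\<Sum>j\<le>length w. \<Sum>i\<le>length A.
        subst_word p (take i A) (take j w) * (if length A - i = 1 then subst_word p (drop i A) (drop j w) else 0))"
      by (simp add: exp_coeff_linear exp_coeff_shuffle13_conc24[OF p] exp_coeff_cosubst[OF p] exp_coeff_U_star[OF p]
          del: basis_Nil)
    show "exp_coeff p A (cosubst (basis w)) = exp_coeff p A ?R"
    \<comment> \<open>The test word is cut before its last tree, because the factor from
      \<open>U_star\<close> stands on the right and sees single trees only.\<close>
    proof (cases A rule: rev_cases)
      case Nil
      \<comment> \<open>No cut of the empty test word leaves a single tree, and the left side is
        zero because \<open>w\<close> is nonempty.\<close>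
      then show ?thesis
        using assms(1) R by (simp add: exp_coeff_cosubst[OF p] lookup_1 del: basis_Nil)
    next
      case (snoc B t)
      have "(\<Sum>i\<le>length A. subst_word p (take i A) (take j w) *
          (if length A - i = 1 then subst_word p (drop i A) (drop j w) else 0)) =
          (\<Sum>i\<le>length A. if i = length B then subst_word p B (take j w) * subst_word p [t] (drop j w) else 0)" for j
        by (rule sum.cong) (auto simp: snoc)
      then have "exp_coeff p A ?R = conc_hat (subst_word p B) (subst_word p [t]) w"
        unfolding R conc_hat_eq by (simp add: snoc)
      then show ?thesis
        by (simp add: exp_coeff_cosubst[OF p] snoc subst_word_append del: subst_word.simps)
    qed
  qed
  \<comment> \<open>The two sums agree for each cut of \<open>w\<close> separately, whatever the
    first factor \<open>X\<close> is.\<close>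
  have step: "shuffle13_conc24 (X \<otimes> U_star (basis v)) =
      sweedler (\<lambda>\<omega>21 \<omega>22. shuffle135_conc24 (X \<otimes> map_second Bplus (cosubst \<omega>21) \<otimes> euler_idem \<omega>22)) (dual_tri (basis v))"
    for X :: "forest \<times> forest \<Rightarrow>\<^sub>0 'k" and v
  proof (rule exp_coeff_eqI)
    fix p :: "forest \<Rightarrow> 'k" and A assume p: "p \<in> lie_hat"
    \<comment> \<open>At a tree \<open>Node B\<close> this is the coefficient of \<open>v\<close> in
      a_p(B) \<rhd> p, expanded by \<open>dual_tri\<close>; at words that are not single trees both
      sides vanish.\<close>
    have U: "exp_coeff p C (U_star (basis v)) = pairing (\<lambda>(a, b). exp_coeff p C (map_second Bplus (cosubst (basis a))) * p b)
        (dual_tri (basis v))" for C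
    proof (cases "length C = 1")
      case True
      then obtain B where C: "C = [Node B]" by (metis One_nat_def length_0_conv length_Suc_conv tree.exhaust)
      show ?thesis
        by (simp add: C exp_coeff_U_star[OF p] exp_coeff_Bplus exp_coeff_cosubst[OF p] tri_hat_def del: basis_Nil)
    qed (simp add: exp_coeff_U_star[OF p] exp_coeff_Bplus case_prod_unfold)
    have "exp_coeff p A (shuffle13_conc24 (X \<otimes> U_star (basis v))) =
        pairing (\<lambda>(a, b). (\<Sum>i\<le>length A. exp_coeff p (take i A) X *
          exp_coeff p (drop i A) (map_second Bplus (cosubst (basis a)))) * p b) (dual_tri (basis v))"
      by (simp add: exp_coeff_shuffle13_conc24[OF p] U case_prod_unfold sum_distrib_right mult.assoc
          pairing_fun_sum pairing_fun_mult del: basis_Nil)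
    also have "\<dots> = exp_coeff p A (sweedler (\<lambda>\<omega>21 \<omega>22.
        shuffle135_conc24 (X \<otimes> map_second Bplus (cosubst \<omega>21) \<otimes> euler_idem \<omega>22)) (dual_tri (basis v)))"
      by (simp add: sweedler_def exp_coeff_linear case_prod_unfold exp_coeff_shuffle135_conc24[OF p]
          pairing_exp_euler[OF p] del: basis_Nil)
    finally show "exp_coeff p A (shuffle13_conc24 (X \<otimes> U_star (basis v))) = \<dots>" .
  qed
  show "sweedler (\<lambda>\<omega>1 \<omega>2. shuffle13_conc24 (cosubst \<omega>1 \<otimes> U_star \<omega>2)) (deconc \<omega>) =
      sweedler (\<lambda>\<omega>1 \<omega>2. sweedler (\<lambda>\<omega>21 \<omega>22.
        shuffle135_conc24 (cosubst \<omega>1 \<otimes> map_second Bplus (cosubst \<omega>21) \<otimes> euler_idem \<omega>22)) (dual_tri \<omega>2)) (deconc \<omega>)"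
    unfolding \<open>\<omega> = basis w\<close> sweedler_deconc step ..
qed

end
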